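(* For every lower semicomputable chronological contextual semimeasure $\nu$, AINU is $\Delta^0_3$; that is, there is a $\nu$-optimal deterministic policy $\pi^*_\nu$ whose graph $\{(h,a):\pi^*_\nu(h)=a\}$ is a $\Delta^0_3$ set.
   Context: The action set $\mathcal{A}$ and percept set $\mathcal{E}$ are finite; a percept is $e=(o,r)$ with reward $r\in[0,1]$. A history is $\ae_{<t}=a_1e_1\ldots a_{t-1}e_{t-1}\in(\mathcal{A}\times\mathcal{E})^*$. Policies are deterministic, i.e. maps from histories to actions, and are identified with their graphs, encoded as sets of natural numbers in some fixed computable way; $\Delta^0_n,\Sigma^0_n,\Pi^0_n$ refer to the arithmetical hierarchy. A chronological contextual semimeasure $\nu$ assigns to all equal-length $e_{1:t}\in\mathcal{E}^t$, $a_{1:t}\in\mathcal{A}^t$ a number $\nu(e_{1:t}\,\|\,a_{1:t})\in[0,1]$ with $\nu(\epsilon\,\|\,\epsilon)\le1$ and $\sum_{e_t\in\mathcal{E}}\nu(e_{1:t}\,\|\,a_{1:t})\le\nu(e_{<t}\,\|\,a_{<t})$. It is lower semicomputable if $\{(e_{1:t},a_{1:t},q):q\in\mathbb{Q},\ \nu(e_{1:t}\,\|\,a_{1:t})>q\}$ is recursively enumerable. The discount function $\gamma:\mathbb{N}\to\mathbb{R}_{\ge0}$ is computable and summable, $\Gamma_t:=\sum_{k\ge t}\gamma_k$. The value of $\pi$ in $\nu$ after a history with $\nu(e_{<t}\,\|\,a_{<t})>0$ is $$V^\pi_\nu(\ae_{<t})=\frac1{\Gamma_t}\sum_{k=t}^\infty\gamma_k\sum_{e_{t:k}}r_k\,\frac{\nu(e_{1:k}\,\|\,a_{1:k})}{\nu(e_{<t}\,\|\,a_{<t})},\qquad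 a_i:=\pi(\ae_{<i})\text{ for }i\ge t,$$ if $\Gamma_t>0$, and $0$ if $\Gamma_t=0$; $V^*_\nu:=\sup_\pi V^\pi_\nu$. A policy is $\nu$-optimal if $V^\pi_\nu(\ae_{<t})=V^*_\nu(\ae_{<t})$ for all histories (at which the value is defined). AINU denotes a $\nu$-optimal policy.
   Formalization: The rewards of the finitely many percepts are additionally assumed to be computable real numbers (as all rational rewards are); for arbitrary real rewards in [0,1] the claim fails, e.g. for a reward that is not a Δ⁰₃ real. *)

theory Defs
  imports Complex_Main "HOL-Library.Nat_Bijection" "HOL-Library.Countable_Set"
begin

section \<open>Recursive functions and the arithmetical hierarchy\<close>

text \<open>
  An \<open>n\<close>-ary function on the naturals is represented as a function on lists, of which only the
  values on lists of length \<open>n\<close> matter (hence the rule \<open>ext\<close>). The class consists of the total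
  recursive functions: minimisation is only applied to regular functions.
\<close>

inductive recursive :: "nat \<Rightarrow> (nat list \<Rightarrow> nat) \<Rightarrow> bool" where
  zero: "recursive n (\<lambda>xs. 0)"
| succ: "recursive 1 (\<lambda>xs. Suc (xs ! 0))"
| proj: "i < n \<Longrightarrow> recursive n (\<lambda>xs. xs ! i)"
| comp: "recursive (length gs) f \<Longrightarrow> \<forall>g \<in> set gs. recursive n g \<Longrightarrow>
    recursive n (\<lambda>xs. f (map (\<lambda>g. g xs) gs))"
| prec: "recursive n f \<Longrightarrow> recursive (Suc (Suc n)) g \<Longrightarrow>
    recursive (Suc n) (\<lambda>xs. rec_nat (f (tl xs)) (\<lambda>k r. g (k # r # tl xs)) (hd xs))"
| mu: "recursive (Suc n) f \<Longrightarrow> \<forall>xs. length xs = n \<longrightarrow> (\<exists>k. f (k # xs) = 0) \<Longrightarrow>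
    recursive n (\<lambda>xs. LEAST k. f (k # xs) = 0)"
| ext: "recursive n f \<Longrightarrow> \<forall>xs. length xs = n \<longrightarrow> f xs = g xs \<Longrightarrow> recursive n g"

definition recursive_rel :: "nat \<Rightarrow> (nat list \<Rightarrow> bool) \<Rightarrow> bool" where
  "recursive_rel n R \<longleftrightarrow> recursive n (\<lambda>xs. of_bool (R xs))"

definition recursively_enumerable :: "nat set \<Rightarrow> bool" where
  "recursively_enumerable S \<longleftrightarrow> S = {} \<or> (\<exists>f. recursive 1 f \<and> S = range (\<lambda>n. f [n]))"

text \<open>\<open>n\<close> alternating quantifiers, the outermost one existential iff the first argument is true.\<close>

fun alternating :: "bool \<Rightarrow> nat \<Rightarrow> (nat list \<Rightarrow> bool) \<Rightarrow> nat list \<Rightarrow> bool" where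
  "alternating b 0 R xs = R xs"
| "alternating True (Suc n) R xs = (\<exists>y. alternating False n R (xs @ [y]))"
| "alternating False (Suc n) R xs = (\<forall>y. alternating True n R (xs @ [y]))"

definition Sigma0 :: "nat \<Rightarrow> nat set \<Rightarrow> bool" where
  "Sigma0 n S \<longleftrightarrow> (\<exists>R. recursive_rel (Suc n) R \<and> S = {x. alternating True n R [x]})"

definition Pi0 :: "nat \<Rightarrow> nat set \<Rightarrow> bool" where
  "Pi0 n S \<longleftrightarrow> Sigma0 n (- S)"

definition Delta0 :: "nat \<Rightarrow> nat set \<Rightarrow> bool" where
  "Delta0 n S \<longleftrightarrow> Sigma0 n S \<and> Pi0 n S"

section \<open>Computability of real-valued functions\<close>

text \<open>Rationals are coded by numerator and (positive) denominator in lowest terms.\<close>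

definition rat_encode :: "rat \<Rightarrow> nat" where
  "rat_encode q = (case quotient_of q of (n, d) \<Rightarrow> prod_encode (int_encode n, nat d))"

definition lower_semicomputable_on :: "('x \<Rightarrow> nat) \<Rightarrow> 'x set \<Rightarrow> ('x \<Rightarrow> real) \<Rightarrow> bool" where
  "lower_semicomputable_on enc X f \<longleftrightarrow>
    recursively_enumerable {prod_encode (enc x, rat_encode q) | x q. x \<in> X \<and> f x > of_rat q}"

definition computable_on :: "('x \<Rightarrow> nat) \<Rightarrow> 'x set \<Rightarrow> ('x \<Rightarrow> real) \<Rightarrow> bool" where
  "computable_on enc X f \<longleftrightarrow>
    lower_semicomputable_on enc X f \<and> lower_semicomputable_on enc X (\<lambda>x. - f x)"

section \<open>Agents and environments\<close>

text \<open>
  The actions form a finite type \<open>'a\<close>; the percepts form a finite set \<open>E\<close> of pairs of an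
  observation and a reward. A history of length \<open>t - 1\<close> lists the pairs \<open>(a\<^sub>i, e\<^sub>i)\<close> for \<open>i < t\<close>
  in chronological order.
\<close>

type_synonym 'o percept = "'o \<times> real"
type_synonym ('a, 'o) history = "('a \<times> 'o percept) list"
type_synonym ('a, 'o) policy = "('a, 'o) history \<Rightarrow> 'a"
type_synonym ('a, 'o) environment = "'o percept list \<Rightarrow> 'a list \<Rightarrow> real"

abbreviation reward :: "'o percept \<Rightarrow> real" where
  "reward \<equiv> snd"

definition histories :: "'o percept set \<Rightarrow> ('a, 'o) history set" where
  "histories E = lists (UNIV \<times> E)"

definition env_domain :: "'o percept set \<Rightarrow> ('o percept list \<times> 'a list) set" where
  "env_domain E = {(es, as). es \<in> lists E \<and> length as = length es}"

definition chronological_semimeasure :: "'o percept set \<Rightarrow> ('a, 'o) environment \<Rightarrow> bool" where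
  "chronological_semimeasure E \<nu> \<longleftrightarrow>
    (\<forall>(es, as) \<in> env_domain E. 0 \<le> \<nu> es as \<and> \<nu> es as \<le> 1) \<and>
    \<nu> [] [] \<le> 1 \<and>
    (\<forall>(es, as) \<in> env_domain E. \<forall>a. (\<Sum>e\<in>E. \<nu> (es @ [e]) (as @ [a])) \<le> \<nu> es as)"

text \<open>
  For a finite set \<open>S\<close>, the function \<open>to_nat_on S\<close> is a bijection onto \<open>{..<card S}\<close>; which of
  these finitely many numberings is used has no influence on computability.
\<close>

definition word_encode :: "'x set \<Rightarrow> 'x list \<Rightarrow> nat" where
  "word_encode S xs = list_encode (map (to_nat_on S) xs)"

definition env_encode :: "'o percept set \<Rightarrow> 'o percept list \<times> 'a::finite list \<Rightarrow> nat" where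
  "env_encode E = (\<lambda>(es, as). prod_encode (word_encode E es, word_encode UNIV as))"

definition history_encode :: "'o percept set \<Rightarrow> ('a::finite, 'o) history \<Rightarrow> nat" where
  "history_encode E h =
    list_encode (map (\<lambda>(a, e). prod_encode (to_nat_on UNIV a, to_nat_on E e)) h)"

definition lower_semicomputable_env :: "'o percept set \<Rightarrow> ('a::finite, 'o) environment \<Rightarrow> bool" where
  "lower_semicomputable_env E \<nu> \<longleftrightarrow>
    lower_semicomputable_on (env_encode E) (env_domain E) (\<lambda>(es, as). \<nu> es as)"

definition policy_graph :: "'o percept set \<Rightarrow> ('a::finite, 'o) policy \<Rightarrow> nat set" where
  "policy_graph E \<pi> =
    {prod_encode (history_encode E h, to_nat_on UNIV a) | h a. h \<in> histories E \<and> \<pi> h = a}"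

section \<open>Values\<close>

text \<open>The continuation of a history in which \<open>\<pi>\<close> acts and the given percepts are received.\<close>

fun continue :: "('a, 'o) policy \<Rightarrow> ('a, 'o) history \<Rightarrow> 'o percept list \<Rightarrow> ('a, 'o) history" where
  "continue \<pi> h [] = h"
| "continue \<pi> h (e # es) = continue \<pi> (h @ [(\<pi> h, e)]) es"

definition hist_prob :: "('a, 'o) environment \<Rightarrow> ('a, 'o) history \<Rightarrow> real" where
  "hist_prob \<nu> h = \<nu> (map snd h) (map fst h)"

definition discount_tail :: "(nat \<Rightarrow> real) \<Rightarrow> nat \<Rightarrow> real" where
  "discount_tail \<gamma> t = (\<Sum>j. \<gamma> (t + j))"

text \<open>
  Time starts at 1, so the current time is \<open>t = length h + 1\<close>. The sum over \<open>k \<ge> t\<close> is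
  indexed by \<open>j = k - t\<close>, and \<open>es\<close> stands for \<open>e\<^sub>t, \<dots>, e\<^sub>k\<close>.
\<close>

definition policy_value ::
  "'o percept set \<Rightarrow> (nat \<Rightarrow> real) \<Rightarrow> ('a, 'o) environment \<Rightarrow> ('a, 'o) policy \<Rightarrow>
   ('a, 'o) history \<Rightarrow> real" where
  "policy_value E \<gamma> \<nu> \<pi> h =
    (let t = Suc (length h) in
     if discount_tail \<gamma> t > 0 then
       1 / discount_tail \<gamma> t *
       (\<Sum>j. \<gamma> (t + j) *
         (\<Sum>es | es \<in> lists E \<and> length es = Suc j.
            reward (last es) * (hist_prob \<nu> (continue \<pi> h es) / hist_prob \<nu> h)))
     else 0)"

definition optimal_value ::
  "'o percept set \<Rightarrow> (nat \<Rightarrow> real) \<Rightarrow> ('a, 'o) environment \<Rightarrow> ('a, 'o) history \<Rightarrow> real" where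
  "optimal_value E \<gamma> \<nu> h = (SUP \<pi>. policy_value E \<gamma> \<nu> \<pi> h)"

definition optimal_policy ::
  "'o percept set \<Rightarrow> (nat \<Rightarrow> real) \<Rightarrow> ('a, 'o) environment \<Rightarrow> ('a, 'o) policy \<Rightarrow> bool" where
  "optimal_policy E \<gamma> \<nu> \<pi> \<longleftrightarrow>
    (\<forall>h \<in> histories E. hist_prob \<nu> h > 0 \<longrightarrow> policy_value E \<gamma> \<nu> \<pi> h = optimal_value E \<gamma> \<nu> h)"

end

theory Submission
  imports Defs "HOL-Library.Cardinality"
begin

text \<open>
  Drop the normalisation from the value: for a fixed history \<open>h\<close> it is a positive constant. The
  remaining expected discounted reward of a policy is a sum of nonnegative terms
  \<open>\<gamma>\<^sub>k r\<^sub>k \<nu>(e\<^sub>1\<^sub>:\<^sub>k | a\<^sub>1\<^sub>:\<^sub>k)\<close> over the extensions of \<open>h\<close> that are consistent with the policy, so the supremum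
  \<open>Q(h, a)\<close> over all policies with \<open>\<pi>(h) = a\<close> is also the supremum over all finite partial sums and
  all finite policy tables. Hence \<open>Q\<close> is lower semicomputable, and \<open>Q(h, b) \<le> Q(h, a)\<close> is a
  \<open>\<Pi>\<^sup>0\<^sub>2\<close> relation. Choosing in every history the first action that maximises \<open>Q(h, \<cdot>)\<close> is a
  conjunction of a \<open>\<Pi>\<^sup>0\<^sub>2\<close> and a \<open>\<Sigma>\<^sup>0\<^sub>2\<close> condition, and a function whose graph is \<open>\<Sigma>\<^sup>0\<^sub>3\<close> on a decidable
  domain has a \<open>\<Delta>\<^sup>0\<^sub>3\<close> graph. The greedy policy is optimal because the summable discount makes
  the tail of the value vanish.
\<close>

section \<open>Recursive functions on coded types\<close>

text \<open>Normalised values cannot simply be approximated from below: the divisor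
  \<open>hist_prob\<close> is itself only approximated from below, which bounds the quotient from
  the wrong side. At a fixed history all actions share the divisor, so comparing the numerators is
  enough. Ties between suprema cannot be detected at any finite stage. Hence each comparison costs
  two quantifiers, and a third is spent on ruling out the smaller actions. Policies are infinite
  objects, so a supremum over them is not a supremum over numbers. A finite sum of gains, however,
  consults the policy at finitely many histories only, so tables coded by numbers suffice. Recursive
  functions are total here. Rewards, probabilities and gains are therefore extended by 0 to all
  codes; as they are nonnegative, 0 is always a legitimate approximation from below.
  \<open>Q(h, a)\<close> leaves the policy free after the action \<open>a\<close>, so the existence
  of an optimal policy is not presupposed.\<close>

class coded =
  fixes enc :: "'a \<Rightarrow> nat" and dec :: "nat \<Rightarrow> 'a"
  assumes dec_enc [simp]: "dec (enc x) = x"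
    and enc_dec [simp]: "enc (dec n) = n"

lemma enc_eq_iff [simp]: "enc x = enc y \<longleftrightarrow> x = y"
  by (metis dec_enc)

instantiation nat :: coded
begin
definition "enc (n :: nat) = n"
definition "dec (n :: nat) = n"
instance by standard (simp_all add: enc_nat_def dec_nat_def)
end

text \<open>The codes of pairs and lists are \<open>prod_encode\<close> and
  \<open>list_encode\<close>, so they agree with those in \<open>history_encode\<close> and
  \<open>env_encode\<close>. As \<open>enc\<close> is a bijection onto the naturals, a quantifier
  over a coded type is a quantifier over numbers.\<close>

instantiation prod :: (coded, coded) coded
begin
definition "enc p = prod_encode (enc (fst p), enc (snd p))"
definition "dec n = (dec (fst (prod_decode n)), dec (snd (prod_decode n)))"
instance by standard (simp_all add: enc_prod_def dec_prod_def)
end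

instantiation list :: (coded) coded
begin
definition "enc xs = list_encode (map enc xs)"
definition "dec n = map dec (list_decode n)"
instance by standard (simp_all add: enc_list_def dec_list_def comp_def)
end

section \<open>Closure properties of recursive functions on argument lists\<close>

lemma recursive_cong: "recursive n f \<Longrightarrow> (\<And>xs. length xs = n \<Longrightarrow> f xs = g xs) \<Longrightarrow> recursive n g"
  by (blast intro: recursive.ext)

lemma recursive_comp1:
  assumes "recursive 1 (\<lambda>xs. f (xs ! 0))" "recursive n g"
  shows "recursive n (\<lambda>xs. f (g xs))"
  using recursive.comp[of "[g]" "\<lambda>xs. f (xs ! 0)" n] assms by simp

lemma recursive_comp2:
  assumes "recursive 2 (\<lambda>xs. f (xs ! 0) (xs ! 1))" "recursive n g" "recursive n h"
  shows "recursive n (\<lambda>xs. f (g xs) (h xs))"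
  using recursive.comp[of "[g, h]" "\<lambda>xs. f (xs ! 0) (xs ! 1)" n] assms
  by (simp add: numeral_2_eq_2)

lemma recursive_Suc: "recursive n f \<Longrightarrow> recursive n (\<lambda>xs. Suc (f xs))"
  using recursive_comp1[of Suc n f] recursive.succ by simp

lemma recursive_const: "recursive n (\<lambda>xs. c)"
  by (induction c) (auto intro: recursive.zero recursive_Suc)

text \<open>\<open>prec\<close> recurses on the head of the argument list. Composing it with
  \<open>m\<close> followed by all projections feeds it the list \<open>m xs # xs\<close>, so the
  bound may depend on the same arguments as the base and the step.\<close>

lemma recursive_rec_nat:
  assumes "recursive n b" "recursive (Suc (Suc n)) (\<lambda>xs. g (xs ! 0) (xs ! 1) (drop 2 xs))"
    and "recursive n m"
  shows "recursive n (\<lambda>xs. rec_nat (b xs) (\<lambda>k r. g k r xs) (m xs))"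
proof -
  let ?F = "\<lambda>xs. rec_nat (b (tl xs)) (\<lambda>k r. g ((k # r # tl xs) ! 0) ((k # r # tl xs) ! 1)
    (drop 2 (k # r # tl xs))) (hd xs)"
  let ?gs = "m # map (\<lambda>i xs. xs ! i) [0..<n]"
  have F: "recursive (Suc n) ?F"
    by (rule recursive.prec) (use assms in auto)
  have "recursive n (\<lambda>xs. ?F (map (\<lambda>g. g xs) ?gs))"
    by (rule recursive.comp) (use F assms(3) in \<open>auto intro: recursive.proj\<close>)
  then show ?thesis
  proof (rule recursive_cong)
    fix xs :: "nat list" assume "length xs = n"
    then have "map (\<lambda>g. g xs) ?gs = m xs # xs"
      by (auto simp: comp_def map_nth)
    then show "?F (map (\<lambda>g. g xs) ?gs) = rec_nat (b xs) (\<lambda>k r. g k r xs) (m xs)"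
      by simp
  qed
qed

text \<open>\<open>mu\<close> searches for a zero, so the indicator of \<open>P\<close> has to be
  negated. Recursion on the truth value does this: 0 is sent to 1 and a successor to 0.\<close>

lemma recursive_Least:
  assumes "recursive (Suc n) (\<lambda>xs. of_bool (P (xs ! 0) (tl xs)))" "\<And>xs. \<exists>k. P k xs"
  shows "recursive n (\<lambda>xs. LEAST k. P k xs)"
proof -
  have step: "recursive (Suc n) (\<lambda>xs. rec_nat 1 (\<lambda>k r. 0) (of_bool (P (xs ! 0) (tl xs))))"
    by (rule recursive_rec_nat[where g = "\<lambda>_ _ _. 0"])
       (use assms(1) in \<open>auto intro: recursive_const recursive.zero\<close>)
  have "recursive n (\<lambda>xs. LEAST k. (\<lambda>xs. rec_nat 1 (\<lambda>k r. 0 :: nat)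
    (of_bool (P (xs ! 0) (tl xs)))) (k # xs) = 0)"
    by (rule recursive.mu[OF step]) (use assms(2) in \<open>auto simp: ex_in_conv split: if_splits\<close>)
  moreover have "rec_nat 1 (\<lambda>k r. 0 :: nat) (of_bool b) = 0 \<longleftrightarrow> b" for b
    by (cases b) auto
  ultimately show ?thesis by simp
qed

lemma recursive_nth_drop: "k + i < n \<Longrightarrow> recursive n (\<lambda>xs. drop k xs ! i)"
  by (rule recursive_cong[OF recursive.proj[of "k + i"]]) auto

lemma recursive_nth_tl: "Suc i < n \<Longrightarrow> recursive n (\<lambda>xs. tl xs ! i)"
  by (rule recursive_cong[OF recursive.proj[of "Suc i"]]) (auto simp: nth_tl)

lemmas recursive_basic = recursive_Suc recursive_const recursive.proj recursive_nth_drop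
  recursive_nth_tl

lemma recursive_add: "recursive n f \<Longrightarrow> recursive n g \<Longrightarrow> recursive n (\<lambda>xs. f xs + g xs)"
proof -
  assume *: "recursive n f" "recursive n g"
  have "recursive 2 (\<lambda>xs. rec_nat (xs ! 0) (\<lambda>k r. Suc r) (xs ! 1))"
    by (rule recursive_rec_nat[where g = "\<lambda>_ r _. Suc r"]) (intro recursive_basic; simp)+
  moreover have "rec_nat a (\<lambda>k r. Suc r) b = a + b" for a b
    by (induction b) auto
  ultimately show ?thesis
    using recursive_comp2[OF _ *, of "(+)"] by simp
qed

lemma recursive_pred: "recursive n f \<Longrightarrow> recursive n (\<lambda>xs. f xs - 1)"
proof -
  assume *: "recursive n f"
  have "recursive 1 (\<lambda>xs. rec_nat 0 (\<lambda>k r. k) (xs ! 0))"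
    by (rule recursive_rec_nat[where g = "\<lambda>k _ _. k"]) (intro recursive_basic; simp)+
  moreover have "rec_nat 0 (\<lambda>k r. k) b = b - 1" for b
    by (cases b) auto
  ultimately show ?thesis
    using recursive_comp1[OF _ *, of "\<lambda>b. b - 1"] by simp
qed

lemma recursive_diff: "recursive n f \<Longrightarrow> recursive n g \<Longrightarrow> recursive n (\<lambda>xs. f xs - g xs)"
proof -
  assume *: "recursive n f" "recursive n g"
  have "recursive 2 (\<lambda>xs. rec_nat (xs ! 0) (\<lambda>k r. r - 1) (xs ! 1))"
    by (rule recursive_rec_nat[where g = "\<lambda>_ r _. r - 1"])
       (intro recursive_basic recursive_pred; simp)+
  moreover have "rec_nat a (\<lambda>k r. r - 1) b = a - b" for a b :: nat
    by (induction b) auto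
  ultimately show ?thesis
    using recursive_comp2[OF _ *, of "(-)"] by simp
qed

lemma recursive_mult: "recursive n f \<Longrightarrow> recursive n g \<Longrightarrow> recursive n (\<lambda>xs. f xs * g xs)"
proof -
  assume *: "recursive n f" "recursive n g"
  have "recursive 2 (\<lambda>xs. rec_nat 0 (\<lambda>k r. r + xs ! 0) (xs ! 1))"
    by (rule recursive_rec_nat[where g = "\<lambda>_ r ys. r + ys ! 0"])
       (intro recursive_basic recursive_add; simp)+
  moreover have "rec_nat 0 (\<lambda>k r. r + a) b = a * b" for a b :: nat
    by (induction b) auto
  ultimately show ?thesis
    using recursive_comp2[OF _ *, of "(*)"] by simp
qed

lemma recursive_not:
  assumes "recursive n (\<lambda>xs. of_bool (P xs))"
  shows "recursive n (\<lambda>xs. of_bool (\<not> P xs))"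
  by (rule recursive_cong[OF recursive_diff[OF recursive_const[of n 1] assms]]) simp

lemma recursive_conj:
  assumes "recursive n (\<lambda>xs. of_bool (P xs))" "recursive n (\<lambda>xs. of_bool (Q xs))"
  shows "recursive n (\<lambda>xs. of_bool (P xs \<and> Q xs))"
  using recursive_mult[OF assms] by (simp add: of_bool_conj)

lemma recursive_less:
  assumes "recursive n f" "recursive n g"
  shows "recursive n (\<lambda>xs. of_bool (f xs < g xs))"
proof -
  have "(1::nat) - (1 - (b - a)) = of_bool (a < b)" for a b :: nat
    by auto
  then show ?thesis
    using recursive_diff[OF recursive_const[of n 1]
      recursive_diff[OF recursive_const[of n 1] recursive_diff[OF assms(2,1)]]] by simp
qed

text \<open>Exhibits division as a search that always succeeds: for \<open>b = 0\<close> the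
  condition already holds at 0, the conventional quotient. It is phrased by negation, conjunction
  and \<open><\<close>, whose recursiveness has just been shown.\<close>

lemma div_eq_Least: "a div b = (LEAST q. \<not> (0 < b \<and> \<not> a < Suc q * b))" for a b :: nat
proof (rule Least_equality[symmetric])
  show "\<not> (0 < b \<and> \<not> a < Suc (a div b) * b)"
    using dividend_less_div_times[of b a] by (cases "b = 0") simp_all
  fix q assume "\<not> (0 < b \<and> \<not> a < Suc q * b)"
  then consider "b = 0" | "a < Suc q * b" by blast
  then show "a div b \<le> q"
    by cases (auto dest: less_mult_imp_div_less simp del: mult_Suc)
qed

lemma recursive_div:
  assumes "recursive n f" "recursive n g"
  shows "recursive n (\<lambda>xs. f xs div g xs)"
proof -
  let ?P = "\<lambda>q xs. \<not> (0 < xs ! 1 \<and> \<not> xs ! 0 < Suc q * xs ! 1)"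
  have "recursive 2 (\<lambda>xs. LEAST q. ?P q xs)"
  proof (rule recursive_Least)
    show "recursive (Suc 2) (\<lambda>xs. of_bool (?P (xs ! 0) (tl xs)))"
      by (intro recursive_not recursive_conj recursive_less recursive_mult recursive_basic) simp_all
    fix xs :: "nat list"
    have "x < Suc x * y" if "0 < y" for x y :: nat
      using that by (cases y) auto
    then show "\<exists>q. ?P q xs" by blast
  qed
  then have "recursive 2 (\<lambda>xs. xs ! 0 div xs ! 1)"
    unfolding div_eq_Least .
  then show ?thesis by (rule recursive_comp2) fact+
qed

text \<open>Inverts the Cantor pairing \<open>triangle (a + b) + a\<close>: \<open>d\<close> is the
  diagonal \<open>a + b\<close>, the last one that starts at or below \<open>n\<close>, and the
  offset on it is \<open>a\<close>.\<close>

lemma prod_decode_eq_Least: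
  "prod_decode n = (let d = (LEAST d. n < triangle (Suc d)); m = n - triangle d in (m, d - m))"
proof -
  obtain a b where ab: "prod_decode n = (a, b)" by fastforce
  then have n: "n = triangle (a + b) + a"
    using prod_decode_inverse[of n] by (simp add: prod_encode_def)
  have mono: "i \<le> j \<Longrightarrow> triangle i \<le> triangle j" for i j
    by (induction rule: dec_induct) auto
  have "(LEAST d. n < triangle (Suc d)) = a + b"
  proof (rule Least_equality)
    fix d assume "n < triangle (Suc d)"
    then have "\<not> Suc d \<le> a + b" using mono[of "Suc d" "a + b"] n by linarith
    then show "a + b \<le> d" by simp
  qed (simp add: n)
  then show ?thesis unfolding ab Let_def using n by simp
qed

lemma recursive_triangle: "recursive n f \<Longrightarrow> recursive n (\<lambda>xs. triangle (f xs))"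
  unfolding triangle_def by (intro recursive_div recursive_mult recursive_Suc recursive_const)

lemma recursive_prod_decode:
  assumes "recursive n f"
  shows "recursive n (\<lambda>xs. fst (prod_decode (f xs)))" "recursive n (\<lambda>xs. snd (prod_decode (f xs)))"
proof -
  have D: "recursive 1 (\<lambda>xs. LEAST d. xs ! 0 < triangle (Suc d))"
  proof (rule recursive_Least[where P = "\<lambda>d xs. xs ! 0 < triangle (Suc d)"])
    show "recursive (Suc 1) (\<lambda>xs. of_bool (tl xs ! 0 < triangle (Suc (xs ! 0))))"
      by (intro recursive_less recursive_triangle recursive_basic) simp_all
    fix xs :: "nat list"
    show "\<exists>k. xs ! 0 < triangle (Suc k)"
      by (rule exI[of _ "xs ! 0"]) simp
  qed
  note D = recursive_comp1[of "\<lambda>n. LEAST d. n < triangle (Suc d)", OF D assms]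
  show "recursive n (\<lambda>xs. fst (prod_decode (f xs)))"
    unfolding prod_decode_eq_Least Let_def fst_conv snd_conv
    by (intro recursive_diff recursive_triangle assms D)
  show "recursive n (\<lambda>xs. snd (prod_decode (f xs)))"
    unfolding prod_decode_eq_Least Let_def fst_conv snd_conv
    by (intro recursive_diff recursive_triangle assms D)
qed

lemma recursive_prod_encode:
  assumes "recursive n f" "recursive n g"
  shows "recursive n (\<lambda>xs. prod_encode (f xs, g xs))"
  unfolding prod_encode_def case_prod_conv by (intro recursive_add recursive_triangle assms)

section \<open>Computable functions between coded types\<close>

definition computable :: "('x::coded \<Rightarrow> 'y::coded) \<Rightarrow> bool" where
  "computable f \<longleftrightarrow> recursive 1 (\<lambda>xs. enc (f (dec (xs ! 0))))"

abbreviation decidable :: "('x::coded \<Rightarrow> bool) \<Rightarrow> bool" where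
  "decidable P \<equiv> computable (\<lambda>x. of_bool (P x) :: nat)"

named_theorems computable_intros

lemma computable_id [computable_intros]: "computable (\<lambda>x. x)"
  unfolding computable_def using recursive.proj[of 0 1] by simp

lemma computable_const [computable_intros]: "computable (\<lambda>x. c)"
  unfolding computable_def by (rule recursive_const)

lemma computable_Suc [computable_intros]: "computable f \<Longrightarrow> computable (\<lambda>x. Suc (f x))"
  unfolding computable_def enc_nat_def by (rule recursive_Suc)

lemma computable_comp: "computable f \<Longrightarrow> computable g \<Longrightarrow> computable (\<lambda>x. f (g x))"
  unfolding computable_def
  using recursive_comp1[of "\<lambda>n. enc (f (dec n))" 1 "\<lambda>xs. enc (g (dec (xs ! 0)))"] by simp

lemma computable_add [computable_intros]:
    "computable f \<Longrightarrow> computable g \<Longrightarrow> computable (\<lambda>x. f x + g x :: nat)"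
  and computable_diff [computable_intros]:
    "computable f \<Longrightarrow> computable g \<Longrightarrow> computable (\<lambda>x. f x - g x :: nat)"
  and computable_mult [computable_intros]:
    "computable f \<Longrightarrow> computable g \<Longrightarrow> computable (\<lambda>x. f x * g x :: nat)"
  and computable_div [computable_intros]:
    "computable f \<Longrightarrow> computable g \<Longrightarrow> computable (\<lambda>x. f x div g x :: nat)"
  unfolding computable_def enc_nat_def
  by (simp_all add: recursive_add recursive_diff recursive_mult recursive_div)

lemma computable_not [computable_intros]: "decidable P \<Longrightarrow> decidable (\<lambda>x. \<not> P x)"
  and computable_conj [computable_intros]:
    "decidable P \<Longrightarrow> decidable Q \<Longrightarrow> decidable (\<lambda>x. P x \<and> Q x)"
  unfolding computable_def enc_nat_def by (simp_all add: recursive_not recursive_conj)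

lemma computable_disj [computable_intros]:
  assumes "decidable P" "decidable Q"
  shows "decidable (\<lambda>x. P x \<or> Q x)"
  using computable_not[OF computable_conj[OF computable_not[OF assms(1)] computable_not[OF assms(2)]]]
  by simp

lemma computable_imp [computable_intros]:
  assumes "decidable P" "decidable Q"
  shows "decidable (\<lambda>x. P x \<longrightarrow> Q x)"
  using computable_disj[OF computable_not[OF assms(1)] assms(2)] by simp

lemma computable_less [computable_intros]:
  "computable f \<Longrightarrow> computable g \<Longrightarrow> decidable (\<lambda>x. f x < (g x :: nat))"
  unfolding computable_def enc_nat_def by (simp add: recursive_less)

lemma computable_le [computable_intros]:
  "computable f \<Longrightarrow> computable g \<Longrightarrow> decidable (\<lambda>x. f x \<le> (g x :: nat))"
  unfolding not_less[symmetric] by (intro computable_intros)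

lemma computable_enc [computable_intros]: "computable f \<Longrightarrow> computable (\<lambda>x. enc (f x))"
  unfolding computable_def enc_nat_def .

lemma computable_dec [computable_intros]: "computable f \<Longrightarrow> computable (\<lambda>x. dec (f x))"
  unfolding computable_def enc_nat_def by simp

lemma computable_via_enc: "computable (\<lambda>x. enc (f x)) \<Longrightarrow> computable f"
  unfolding computable_def enc_nat_def .

lemma computable_eq [computable_intros]:
  fixes f g :: "'x::coded \<Rightarrow> 'y::coded"
  assumes "computable f" "computable g"
  shows "decidable (\<lambda>x. f x = g x)"
proof -
  have "decidable (\<lambda>x. enc (f x) \<le> enc (g x) \<and> enc (g x) \<le> enc (f x))"
    by (intro computable_intros assms)
  then show ?thesis by (simp add: eq_iff[symmetric])
qed

lemma computable_if [computable_intros]: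
  assumes "decidable P" "computable f" "computable g"
  shows "computable (\<lambda>x. if P x then f x else g x)"
proof (rule computable_via_enc)
  have "computable (\<lambda>x. of_bool (P x) * enc (f x) + (1 - of_bool (P x)) * enc (g x))"
    by (intro computable_intros assms)
  then show "computable (\<lambda>x. enc (if P x then f x else g x))"
    by (rule back_subst[of computable]) auto
qed

lemma computable_Pair [computable_intros]:
  "computable f \<Longrightarrow> computable g \<Longrightarrow> computable (\<lambda>x. (f x, g x))"
  unfolding computable_def enc_prod_def by (simp add: recursive_prod_encode)

lemma computable_prod_decode:
  assumes "computable f"
  shows "computable (\<lambda>x. fst (prod_decode (f x)))" "computable (\<lambda>x. snd (prod_decode (f x)))"
  using assms unfolding computable_def enc_nat_def by (simp_all add: recursive_prod_decode)

lemma computable_fst [computable_intros]: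
  fixes f :: "'x::coded \<Rightarrow> 'y::coded \<times> 'z::coded"
  assumes "computable f"
  shows "computable (\<lambda>x. fst (f x))"
proof -
  have "computable (\<lambda>x. dec (fst (prod_decode (enc (f x)))) :: 'y)"
    by (intro computable_intros computable_prod_decode assms)
  then show ?thesis by (simp add: enc_prod_def)
qed

lemma computable_snd [computable_intros]:
  fixes f :: "'x::coded \<Rightarrow> 'y::coded \<times> 'z::coded"
  assumes "computable f"
  shows "computable (\<lambda>x. snd (f x))"
proof -
  have "computable (\<lambda>x. dec (snd (prod_decode (enc (f x)))) :: 'z)"
    by (intro computable_intros computable_prod_decode assms)
  then show ?thesis by (simp add: enc_prod_def)
qed

text \<open>The recursion runs on codes, where \<open>recursive_rec_nat\<close> applies;
  \<open>enc\<close> commutes with the iteration because \<open>dec\<close> undoes it at every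
  step.\<close>

lemma computable_rec_nat [computable_intros]:
  fixes g :: "'x::coded \<Rightarrow> nat \<Rightarrow> 'y::coded \<Rightarrow> 'y"
  assumes b: "computable b"
    and g: "computable (\<lambda>z :: 'x \<times> nat \<times> 'y. g (fst z) (fst (snd z)) (snd (snd z)))"
    and n: "computable n"
  shows "computable (\<lambda>x. rec_nat (b x) (\<lambda>k r. g x k r) (n x))"
proof -
  let ?G = "\<lambda>k r xs. enc (g (dec (xs ! 0)) k (dec r))"
  have g': "recursive 1 (\<lambda>xs. enc (let z :: 'x \<times> nat \<times> 'y = dec (xs ! 0) in
      g (fst z) (fst (snd z)) (snd (snd z))))"
    using g unfolding computable_def Let_def .
  \<comment> \<open>The recursion supplies counter, previous value and parameter in this order,
    whereas \<open>g\<close> expects the code of \<open>(x, k, r)\<close>.\<close>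
  have "recursive 3 (\<lambda>xs. prod_encode (drop 2 xs ! 0, prod_encode (xs ! 0, xs ! 1)))"
    by (intro recursive_prod_encode recursive_basic) simp_all
  from recursive_comp1[OF g' this] have "recursive (Suc (Suc 1)) (\<lambda>xs. ?G (xs ! 0) (xs ! 1) (drop 2 xs))"
    by (simp add: Let_def dec_prod_def dec_nat_def numeral_3_eq_3)
  then have "recursive 1 (\<lambda>xs. rec_nat (enc (b (dec (xs ! 0)))) (\<lambda>k r. ?G k r xs) (n (dec (xs ! 0))))"
    using b n unfolding computable_def enc_nat_def by (intro recursive_rec_nat)
  moreover have "rec_nat (enc (b x)) (\<lambda>k r. enc (g x k (dec r))) m = enc (rec_nat (b x) (\<lambda>k r. g x k r) m)" for x m
    by (induction m) auto
  ultimately show ?thesis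
    unfolding computable_def by simp
qed

lemma computable_sum [computable_intros]:
  fixes f :: "'x::coded \<Rightarrow> nat \<Rightarrow> nat"
  assumes "computable (\<lambda>z. f (fst z) (snd z))" "computable n"
  shows "computable (\<lambda>x. \<Sum>k<n x. f x k)"
proof -
  have "computable (\<lambda>x. rec_nat 0 (\<lambda>k r. r + f x k) (n x))"
    by (intro computable_intros assms
        computable_comp[OF assms(1), of "\<lambda>z. (fst z, g z)" for g, simplified])
  moreover have "rec_nat 0 (\<lambda>k r. r + f x k) m = (\<Sum>k<m. f x k)" for x m
    by (induction m) auto
  ultimately show ?thesis by simp
qed

text \<open>A bounded universal statement holds iff the number of its counterexamples is 0, and that
  number is a bounded sum.\<close>

lemma computable_ball [computable_intros]:
  assumes "decidable (\<lambda>z. P (fst z) (snd z))" "computable n"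
  shows "decidable (\<lambda>x. \<forall>k<(n x :: nat). P x k)"
proof -
  have "decidable (\<lambda>x. (\<Sum>k<n x. of_bool (\<not> P x k)) = (0 :: nat))"
    by (intro computable_intros assms)
  moreover have "(\<Sum>k<m. of_bool (\<not> P x k)) = (0 :: nat) \<longleftrightarrow> (\<forall>k<m. P x k)" for x m
    by (subst sum_eq_0_iff) auto
  ultimately show ?thesis by simp
qed

text \<open>Out of range, the junk value is fixed so that \<open>nthd\<close> is computable as a total function.\<close>

definition nthd :: "'a::coded list \<Rightarrow> nat \<Rightarrow> 'a" where
  "nthd xs i = (if i < length xs then xs ! i else dec 0)"

section \<open>Computability of list operations\<close>

lemma computable_Cons [computable_intros]:
  assumes "computable f" "computable g"
  shows "computable (\<lambda>x. f x # g x)"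
proof (rule computable_via_enc)
  have "computable (\<lambda>x. Suc (enc (f x, g x)))"
    by (intro computable_intros assms)
  then show "computable (\<lambda>x. enc (f x # g x))"
    by (simp add: enc_list_def enc_prod_def)
qed

lemma enc_Nil: "enc [] = 0" and enc_Cons: "enc (x # xs) = Suc (prod_encode (enc x, enc xs))"
  by (simp_all add: enc_list_def)

lemma prod_decode_0: "prod_decode 0 = (0, 0)"
  using prod_encode_inverse[of "(0, 0)"] by (simp add: prod_encode_def)

lemma computable_tl [computable_intros]:
  fixes f :: "'x::coded \<Rightarrow> 'y::coded list"
  assumes "computable f"
  shows "computable (\<lambda>x. tl (f x))"
proof (rule computable_via_enc)
  have "enc (tl xs) = snd (prod_decode (enc xs - 1))" for xs :: "'y list"
    by (cases xs) (simp_all add: enc_Nil enc_Cons prod_decode_0)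
  then show "computable (\<lambda>x. enc (tl (f x)))"
    by (simp only:) (intro computable_intros computable_prod_decode assms)
qed

lemma computable_drop [computable_intros]:
  assumes "computable f" "computable n"
  shows "computable (\<lambda>x. drop (n x) (f x))"
proof -
  have "rec_nat xs (\<lambda>k r. tl r) m = drop m xs" for m and xs :: "'b list"
    by (induction m) (auto simp: drop_Suc tl_drop)
  then show ?thesis
    using computable_rec_nat[of f "\<lambda>x k r. tl r" n] assms by (simp add: computable_intros)
qed

lemma computable_nthd [computable_intros]:
  fixes f :: "'x::coded \<Rightarrow> 'y::coded list"
  assumes "computable f" "computable n"
  shows "computable (\<lambda>x. nthd (f x) (n x))"
proof -
  have "nthd xs i = dec (fst (prod_decode (enc (drop i xs) - 1)))" for xs :: "'y list" and i
    by (auto simp: nthd_def enc_Nil enc_Cons prod_decode_0 Cons_nth_drop_Suc[symmetric])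
  then show ?thesis
    by (simp only:) (intro computable_intros computable_prod_decode assms)
qed

lemma length_le_enc: "length xs \<le> enc xs"
proof (induction xs)
  case (Cons x xs)
  then show ?case
    using le_prod_encode_2[of "enc xs" "enc x"] by (simp add: enc_Cons)
qed simp

text \<open>The length is the number of \<open>k\<close> with \<open>drop k xs \<noteq> []\<close>.
  A code is at least as large as the length of its list, so the code itself bounds the
  count.\<close>

lemma computable_length [computable_intros]:
  fixes f :: "'x::coded \<Rightarrow> 'y::coded list"
  assumes "computable f"
  shows "computable (\<lambda>x. length (f x))"
proof -
  have "length xs = (\<Sum>k<enc xs. of_bool (drop k xs \<noteq> []))" for xs :: "'y list"
  proof -
    have "{..<enc xs} \<inter> {k. k < length xs} = {..<length xs}"
      using length_le_enc[of xs] by auto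
    then show ?thesis
      by (simp add: sum.If_cases of_bool_def not_le)
  qed
  then show ?thesis
    by (simp only:) (intro computable_intros assms computable_comp[OF assms computable_fst])
qed

lemma computable_tabulate [computable_intros]:
  assumes "computable (\<lambda>z. f (fst z) (snd z))" "computable n"
  shows "computable (\<lambda>x. map (f x) [0..<n x])"
proof -
  \<comment> \<open>The list is built by prepending, hence from its last entry: stage
    \<open>k\<close> puts \<open>f x (m - Suc k)\<close> in front.\<close>
  have "j \<le> m \<Longrightarrow> rec_nat [] (\<lambda>k r. f x (m - Suc k) # r) j = map (f x) [m - j..<m]" for x m j
  proof (induction j)
    case (Suc j)
    then have "[m - Suc j..<m] = (m - Suc j) # [m - j..<m]"
      by (simp add: upt_conv_Cons Suc_diff_Suc)
    with Suc show ?case by simp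
  qed simp
  from this[OF order_refl] have tab: "map (f x) [0..<m] = rec_nat [] (\<lambda>k r. f x (m - Suc k) # r) m" for x m
    by simp
  show ?thesis unfolding tab
    by (intro computable_intros assms
        computable_comp[OF assms(1), of "\<lambda>z. (fst z, g z)" for g, simplified]
        computable_comp[OF assms(2) computable_fst])
qed

lemma map_nthd: "map (\<lambda>i. f (nthd xs i)) [0..<length xs] = map f xs"
  by (auto simp: nthd_def intro: nth_equalityI)

lemma computable_map [computable_intros]:
  assumes "computable (\<lambda>z. f (fst z) (snd z))" "computable l"
  shows "computable (\<lambda>x. map (f x) (l x))"
proof -
  have "computable (\<lambda>x. map (\<lambda>i. f x (nthd (l x) i)) [0..<length (l x)])"
    by (intro computable_intros assms(2) computable_comp[OF assms(2) computable_fst]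
        computable_comp[OF assms(1), of "\<lambda>z. (fst z, g z)" for g, simplified])
  then show ?thesis by (simp only: map_nthd)
qed

section \<open>Lower semicomputable functions\<close>

text \<open>
  The approximations from below need not increase with \<open>s\<close>: this way sums and products are
  approximated termwise. Only nonnegative functions can satisfy this.
\<close>

definition lsc :: "('x::coded \<Rightarrow> real) \<Rightarrow> bool" where
  "lsc f \<longleftrightarrow> (\<exists>A :: 'x \<Rightarrow> nat \<Rightarrow> nat. computable (\<lambda>z. A (fst z) (snd z)) \<and>
    (\<forall>x s. A x s / Suc s \<le> f x) \<and> (\<forall>x. (\<lambda>s. A x s / Suc s) \<longlonglongrightarrow> f x))"

lemma lscI:
  assumes "computable (\<lambda>z. A (fst z) (snd z))" "\<And>x s. real (A x s) / Suc s \<le> f x"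
    "\<And>x. (\<lambda>s. real (A x s) / Suc s) \<longlonglongrightarrow> f x"
  shows "lsc f"
  using assms unfolding lsc_def by blast

lemma lscE:
  assumes "lsc f"
  obtains A where "computable (\<lambda>z. A (fst z) (snd z))" "\<And>x s. real (A x s) / Suc s \<le> f x"
    "\<And>x. (\<lambda>s. real (A x s) / Suc s) \<longlonglongrightarrow> f x"
  using assms unfolding lsc_def by blast

lemma lsc_nonneg: "lsc f \<Longrightarrow> 0 \<le> f x"
  by (erule lscE) (meson divide_nonneg_nonneg of_nat_0_le_iff order_trans)

lemma lsc_comp:
  assumes "lsc f" "computable g"
  shows "lsc (\<lambda>x. f (g x))"
proof -
  from assms(1) obtain A where A: "computable (\<lambda>z. A (fst z) (snd z))"
      "\<And>x s. real (A x s) / Suc s \<le> f x" "\<And>x. (\<lambda>s. real (A x s) / Suc s) \<longlonglongrightarrow> f x"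
    by (rule lscE) blast
  have "computable (\<lambda>z. A (g (fst z)) (snd z))"
    by (intro computable_intros computable_comp[OF assms(2) computable_fst]
        computable_comp[OF A(1), of "\<lambda>z. (g z, h z)" for g h, simplified])
  then show ?thesis
    by (rule lscI) (use A in auto)
qed

text \<open>Rounding down costs at most one unit, hence at most \<open>1 / Suc s\<close> for
  fractions over \<open>Suc s\<close>. For \<open>n = 0\<close> the left side is -1.\<close>

lemma divide_le_of_nat_div: "real m / real n - 1 \<le> real (m div n)"
proof (cases "n = 0")
  case False
  then have "m \<le> (m div n) * n + n"
    using dividend_less_div_times[of n m] by simp
  then have "real m \<le> (real (m div n) + 1) * real n"
    by (simp add: distrib_right flip: of_nat_mult of_nat_add)
  with False have "real m / real n \<le> real (m div n) + 1" by (simp add: pos_divide_le_eq)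
  then show ?thesis by simp
qed simp

text \<open>The product of two fractions over \<open>Suc s\<close> has the square of
  \<open>Suc s\<close> as denominator; rounding its numerator down to a multiple of
  \<open>Suc s\<close> restores the required form, with an error that vanishes in the limit. The
  product stays below \<open>f x * g x\<close> because all factors are nonnegative.\<close>

lemma lsc_mult:
  assumes "lsc f" "lsc g"
  shows "lsc (\<lambda>x. f x * g x)"
proof -
  from assms(1) obtain A where A: "computable (\<lambda>z. A (fst z) (snd z))"
      "\<And>x s. real (A x s) / Suc s \<le> f x" "\<And>x. (\<lambda>s. real (A x s) / Suc s) \<longlonglongrightarrow> f x"
    by (rule lscE) blast
  from assms(2) obtain B where B: "computable (\<lambda>z. B (fst z) (snd z))"
      "\<And>x s. real (B x s) / Suc s \<le> g x" "\<And>x. (\<lambda>s. real (B x s) / Suc s) \<longlonglongrightarrow> g x"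
    by (rule lscE) blast
  let ?p = "\<lambda>x s. real (A x s) / Suc s * (real (B x s) / Suc s)"
  let ?C = "\<lambda>x s. (A x s * B x s) div Suc s"
  have le: "real (?C x s) / Suc s \<le> ?p x s" for x s
  proof -
    have "real (?C x s) / Suc s \<le> real (A x s * B x s) / Suc s / Suc s"
      by (intro divide_right_mono of_nat_div_le_of_nat) simp
    then show ?thesis by (simp only: of_nat_mult times_divide_times_eq divide_divide_eq_left)
  qed
  have ge: "?p x s - 1 / Suc s \<le> real (?C x s) / Suc s" for x s
  proof -
    have "(real (A x s * B x s) / Suc s - 1) / Suc s \<le> real (?C x s) / Suc s"
      using divide_le_of_nat_div[of "A x s * B x s" "Suc s"] by (intro divide_right_mono) simp_all
    then show ?thesis
      by (simp only: of_nat_mult times_divide_times_eq divide_divide_eq_left diff_divide_distrib)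
  qed
  show ?thesis
  proof (rule lscI)
    show "computable (\<lambda>z. ?C (fst z) (snd z))"
      by (intro computable_intros A(1) B(1))
    show "real (?C x s) / Suc s \<le> f x * g x" for x s
      by (rule order_trans[OF le mult_mono]) (use A(2) B(2) lsc_nonneg[OF assms(1)] in auto)
    fix x
    have p: "(\<lambda>s. ?p x s) \<longlonglongrightarrow> f x * g x"
      by (intro tendsto_mult A B)
    have "(\<lambda>s. ?p x s - 1 / Suc s) \<longlonglongrightarrow> f x * g x - 0"
      using LIMSEQ_inverse_real_of_nat by (intro tendsto_diff p) (simp only: inverse_eq_divide)
    then have l: "(\<lambda>s. ?p x s - 1 / Suc s) \<longlonglongrightarrow> f x * g x" by (simp only: diff_0_right)
    show "(\<lambda>s. real (?C x s) / Suc s) \<longlonglongrightarrow> f x * g x"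
      by (rule tendsto_sandwich[OF _ _ l p]) (intro always_eventually allI le ge)+
  qed
qed

text \<open>The index is part of the argument of the approximation, so one algorithm serves all
  terms and their number may depend on \<open>x\<close>.\<close>

lemma lsc_sum:
  fixes f :: "'x::coded \<Rightarrow> nat \<Rightarrow> real"
  assumes "lsc (\<lambda>z. f (fst z) (snd z))" "computable n"
  shows "lsc (\<lambda>x. \<Sum>k<n x. f x k)"
proof -
  from assms(1) obtain A where A: "computable (\<lambda>z. A (fst z) (snd z))"
      "\<And>x s. real (A x s) / Suc s \<le> f (fst x) (snd x)"
      "\<And>x. (\<lambda>s. real (A x s) / Suc s) \<longlonglongrightarrow> f (fst x) (snd x)"
    by (rule lscE) blast
  show ?thesis
  proof (rule lscI)
    show "computable (\<lambda>z. \<Sum>k<n (fst z). A (fst z, k) (snd z))"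
      by (intro computable_intros computable_comp[OF assms(2) computable_fst]
        computable_comp[OF A(1), of "\<lambda>z. (g z, h z)" for g h, simplified])
    show "real (\<Sum>k<n x. A (x, k) s) / Suc s \<le> (\<Sum>k<n x. f x k)" for x s
      unfolding of_nat_sum sum_divide_distrib
      by (intro sum_mono) (use A(2)[of "(x, k)" s for k] in simp)
    show "(\<lambda>s. real (\<Sum>k<n x. A (x, k) s) / Suc s) \<longlonglongrightarrow> (\<Sum>k<n x. f x k)" for x
      unfolding of_nat_sum sum_divide_distrib
      by (intro tendsto_sum) (use A(3)[of "(x, k)" for k] in simp)
  qed
qed

lemma lsc_if:
  assumes "decidable P" "lsc f"
  shows "lsc (\<lambda>x. if P x then f x else 0)"
proof -
  from assms(2) obtain A where A: "computable (\<lambda>z. A (fst z) (snd z))"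
      "\<And>x s. real (A x s) / Suc s \<le> f x" "\<And>x. (\<lambda>s. real (A x s) / Suc s) \<longlonglongrightarrow> f x"
    by (rule lscE) blast
  have "computable (\<lambda>z. if P (fst z) then A (fst z) (snd z) else 0)"
    by (intro computable_intros A computable_comp[OF assms(1) computable_fst])
  then show ?thesis
    by (rule lscI) (use A in auto)
qed

section \<open>From enumerations of rational bounds to approximations\<close>

lemma rat_encode_even:
  assumes "rat_encode q = prod_encode (2 * m, d)"
  shows "real_of_rat q = real m / real d"
proof -
  obtain n k where q: "quotient_of q = (n, k)" by fastforce
  then have "int_encode n = 2 * m" "nat k = d"
    using assms by (auto simp: rat_encode_def)
  moreover have "k > 0" using q by (rule quotient_of_denom_pos)
  moreover have "n = int m"
  proof -
    have "even (int_encode n)" using \<open>int_encode n = 2 * m\<close> by simp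
    then have "0 \<le> n" by (auto simp: int_encode_def sum_encode_def split: if_splits)
    with \<open>int_encode n = 2 * m\<close> show ?thesis by (simp add: int_encode_def sum_encode_def)
  qed
  moreover have "q = of_int n / of_int k" using q by (rule quotient_of_div)
  ultimately show ?thesis by (auto simp: of_rat_divide)
qed

lemma rat_encode_nonneg:
  assumes "0 \<le> q"
  obtains m d where "rat_encode q = prod_encode (2 * m, d)"
proof -
  obtain n k where q: "quotient_of q = (n, k)" by fastforce
  have "k > 0" using q by (rule quotient_of_denom_pos)
  moreover have "q = of_int n / of_int k" using q by (rule quotient_of_div)
  ultimately have "n \<ge> 0" using assms by (simp add: zero_le_divide_iff)
  then have "rat_encode q = prod_encode (2 * nat n, nat k)"
    using q by (simp add: rat_encode_def int_encode_def sum_encode_def)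
  then show thesis by (rule that)
qed

text \<open>Stage \<open>s\<close> inspects the first \<open>Suc s\<close> members of the
  enumeration and keeps the largest bound listed for \<open>y\<close>, rounded down to a multiple of
  \<open>1 / Suc s\<close>. \<open>F\<close> continues \<open>f\<close> by 0 to all codes: where
  nothing is listed, the approximation stays 0. Negative bounds are skipped, which is harmless as
  \<open>F\<close> is nonnegative.\<close>

lemma lsc_of_lower_semicomputable_on:
  fixes F :: "'y::coded \<Rightarrow> real"
  assumes lsc: "lower_semicomputable_on e X f"
    and F: "\<And>x. x \<in> X \<Longrightarrow> F (dec (e x)) = f x"
    and F0: "\<And>y. enc y \<notin> e ` X \<Longrightarrow> F y = 0"
    and nonneg: "\<And>y. 0 \<le> F y"
  shows "lsc F"
proof -
  define S where "S = {prod_encode (e x, rat_encode q) | x q. x \<in> X \<and> f x > of_rat q}"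
  have "S = {} \<or> (\<exists>g. recursive 1 g \<and> S = range (\<lambda>n. g [n]))"
    using lsc unfolding lower_semicomputable_on_def recursively_enumerable_def S_def .
  then consider "S = {}" | g where "recursive 1 g" "S = range (\<lambda>n. g [n])"
    by blast
  then show ?thesis
  proof cases
    case 1
    \<comment> \<open>Below any real number lies a rational, so a member of \<open>X\<close> would
      put an element into \<open>S\<close>.\<close>
    have "X = {}"
    proof (rule equals0I)
      fix x assume "x \<in> X"
      moreover obtain q where "real_of_rat q < f x"
        using of_rat_dense[of "f x - 1" "f x"] by auto
      ultimately have "prod_encode (e x, rat_encode q) \<in> S"
        unfolding S_def by blast
      with 1 show False by simp
    qed
    then have "F y = 0" for y using F0 by simp
    then show ?thesis
      by (intro lscI[of "\<lambda>_ _. 0"]) (auto intro: computable_const)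
  next
    case 2
    define G where "G i = (dec (g [i]) :: 'y \<times> nat \<times> nat)" for i
    have "recursive 1 (\<lambda>xs. g [xs ! 0])"
      by (rule recursive_cong[OF 2(1)]) (auto simp: length_Suc_conv)
    then have G: "computable (\<lambda>x. G (i x))" if "computable i" for i :: "'z::coded \<Rightarrow> nat"
      using computable_comp[OF _ that, of G] by (simp add: computable_def G_def dec_nat_def)
    \<comment> \<open>\<open>G i\<close> is read as code of the point, numerator code and
      denominator. \<open>int_encode\<close> sends \<open>n \<ge> 0\<close> to \<open>2 * n\<close>
      and negative integers to odd numbers, so comparing with twice the half selects the nonnegative
      rationals, and the half is the numerator.\<close>
    define c where "c y s i = (if fst (G i) = y \<and> 2 * (fst (snd (G i)) div 2) = fst (snd (G i))
      then (fst (snd (G i)) div 2 * Suc s) div snd (snd (G i)) else 0)" for y s i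
    define A where "A y s = rec_nat 0 (\<lambda>k r. if r < c y s k then c y s k else r) (Suc s)" for y s
    have "computable (\<lambda>z. A (fst z) (snd z))"
      unfolding A_def c_def by (intro computable_intros G)
    have A_ge: "i \<le> s \<Longrightarrow> c y s i \<le> A y s" for y s i
    proof -
      have "i < m \<Longrightarrow> c y s i \<le> rec_nat 0 (\<lambda>k r. if r < c y s k then c y s k else r) m" for m
        by (induction m) (auto simp: less_Suc_eq intro: order_trans)
      from this[of "Suc s"] show "i \<le> s \<Longrightarrow> c y s i \<le> A y s"
        unfolding A_def by (simp only: less_Suc_eq_le)
    qed
    have A_le: "real (A y s) \<le> b" if "\<And>i. real (c y s i) \<le> b" "0 \<le> b" for y s b
    proof -
      have "real (rec_nat 0 (\<lambda>k r. if r < c y s k then c y s k else r) m) \<le> b" for m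
        by (induction m) (use that in auto)
      then show ?thesis unfolding A_def .
    qed
    have c_le: "real (c y s i) \<le> F y * Suc s" for y s i
    proof (cases "fst (G i) = y \<and> 2 * (fst (snd (G i)) div 2) = fst (snd (G i))")
      case True
      obtain m d where Gi: "G i = (y, 2 * m, d)"
        using True by (metis prod.collapse)
      then have "enc (G i) = prod_encode (enc y, prod_encode (2 * m, d))"
        by (simp add: enc_prod_def enc_nat_def)
      then have "prod_encode (enc y, prod_encode (2 * m, d)) = g [i]"
        unfolding G_def by simp
      then have "prod_encode (enc y, prod_encode (2 * m, d)) \<in> S"
        unfolding 2(2) by (rule range_eqI)
      then obtain x q where xq: "x \<in> X" "e x = enc y" "rat_encode q = prod_encode (2 * m, d)" "of_rat q < f x"
        unfolding S_def by auto
      then have "real m / real d < F y"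
        using F[OF xq(1)] rat_encode_even[OF xq(3)] by simp
      have "real (c y s i) \<le> real (m * Suc s) / real d"
        unfolding c_def Gi by (simp add: of_nat_div_le_of_nat del: mult_Suc_right of_nat_mult)
      also have "\<dots> = real m / real d * Suc s"
        by (simp only: of_nat_mult times_divide_eq_left)
      also have "\<dots> \<le> F y * Suc s"
        using \<open>real m / real d < F y\<close> by (intro mult_right_mono) auto
      finally show ?thesis .
    qed (auto simp: c_def nonneg)
    have le: "A y s / Suc s \<le> F y" for y s
      using A_le[OF c_le, of y s] nonneg[of y] by (simp add: divide_le_eq)
    have "(\<lambda>s. A y s / Suc s) \<longlonglongrightarrow> F y" for y
    proof (cases "F y = 0")
      case True
      have "A y s / Suc s = 0" for s
        using le[of y s] True by (intro antisym) auto
      then show ?thesis using True by simp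
    next
      case False
      then obtain x where x: "x \<in> X" "e x = enc y" using F0[of y] by force
      have "F y > 0" using False nonneg[of y] by simp
      show ?thesis
      proof (rule tendstoI)
        fix \<epsilon> :: real assume "\<epsilon> > 0"
        \<comment> \<open>The maximum with 0 makes \<open>q\<close> positive, so its numerator code
          is even and \<open>c\<close> does not skip it. One half of \<open>\<epsilon>\<close> goes
          to the choice of \<open>q\<close>, the other to the rounding.\<close>
        have "max 0 (F y - \<epsilon>/2) < F y" using \<open>F y > 0\<close> \<open>\<epsilon> > 0\<close> by simp
        then obtain q where q: "max 0 (F y - \<epsilon>/2) < real_of_rat q" "real_of_rat q < F y"
          using of_rat_dense by blast
        then have "0 \<le> q" by simp
        then obtain m d where md: "rat_encode q = prod_encode (2 * m, d)"
          by (rule rat_encode_nonneg)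
        have "of_rat q < f x" using q(2) F[OF x(1)] x(2) by simp
        with x(1) have "prod_encode (e x, rat_encode q) \<in> S"
          unfolding S_def by blast
        then have "prod_encode (enc y, prod_encode (2 * m, d)) \<in> range (\<lambda>n. g [n])"
          unfolding 2(2) md x(2) .
        then obtain i where i: "prod_encode (enc y, prod_encode (2 * m, d)) = g [i]"
          by (rule rangeE)
        then have Gi: "G i = (y, 2 * m, d)"
          unfolding G_def by (simp add: dec_prod_def dec_nat_def flip: i)
        have "eventually (\<lambda>s. 1 / real (Suc s) < \<epsilon>/2) sequentially"
          using \<open>\<epsilon> > 0\<close> by (intro order_tendstoD(2)[OF LIMSEQ_inverse_real_of_nat[unfolded inverse_eq_divide]]) auto
        with eventually_ge_at_top[of i]
        show "eventually (\<lambda>s. dist (A y s / Suc s) (F y) < \<epsilon>) sequentially"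
        proof eventually_elim
          case (elim s)
          have "real (m * Suc s) / real d - 1 \<le> real (c y s i)"
            using divide_le_of_nat_div[of "m * Suc s" d] unfolding c_def Gi
            by (simp del: mult_Suc_right of_nat_mult)
          also have "\<dots> \<le> A y s" using A_ge[OF elim(1)] by simp
          finally have "(real (m * Suc s) / real d - 1) / Suc s \<le> A y s / Suc s"
            by (intro divide_right_mono) auto
          moreover have "real (m * Suc s) / real d = real m / real d * Suc s"
            by (simp only: of_nat_mult times_divide_eq_left)
          ultimately have "real m / real d - 1 / Suc s \<le> A y s / Suc s"
            by (simp only: diff_divide_distrib) (simp del: of_nat_Suc)
          then have "F y - \<epsilon> < A y s / Suc s"
            using rat_encode_even[OF md] q elim(2) by linarith
          then show ?case using le[of y s] \<open>\<epsilon> > 0\<close> by (simp add: dist_real_def)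
        qed
      qed
    qed
    with le \<open>computable (\<lambda>z. A (fst z) (snd z))\<close> show ?thesis by (intro lscI)
  qed
qed

section \<open>Comparison of suprema of lower semicomputable functions\<close>

lemma nonneg_fraction_dense:
  assumes "0 \<le> x" "x < y"
  obtains c d :: nat where "x < c / Suc d" "c / Suc d < y"
proof -
  from assms(2) obtain q where q: "x < real_of_rat q" "real_of_rat q < y"
    using of_rat_dense by blast
  then have "0 \<le> q" using assms(1) by (metis less_le_trans less_le of_rat_less_0_iff not_less order_less_trans)
  then obtain m d where "rat_encode q = prod_encode (2 * m, d)"
    by (rule rat_encode_nonneg)
  from rat_encode_even[OF this] q have "x < m / d" "m / d < y" by auto
  moreover from this assms(1) have "d \<noteq> 0" by (intro notI) simp
  ultimately show thesis using that[of m "d - 1"] by simp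
qed

text \<open>One supremum is at most the other iff every fraction \<open>c / Suc d\<close> exceeded
  by some approximation to the first family is exceeded by some approximation to the second. For
  fixed \<open>k\<close> and \<open>s\<close> the premise is decidable, and the conclusion asks for
  some \<open>k'\<close> and \<open>s'\<close>; this gives the shape forall-exists.\<close>

lemma lsc_SUP_le_iff:
  fixes U :: "'x::coded \<times> 'k::coded \<Rightarrow> real"
  assumes "lsc U" and bdd: "\<And>x. bdd_above (range (\<lambda>k. U (x, k)))"
  obtains R :: "'x \<times> 'x \<Rightarrow> 'k \<times> nat \<times> nat \<times> nat \<Rightarrow> 'k \<times> nat \<Rightarrow> bool"
  where "decidable (\<lambda>z. R (fst z) (fst (snd z)) (snd (snd z)))"
    and "\<And>x y. (SUP k. U (x, k)) \<le> (SUP k. U (y, k)) \<longleftrightarrow> (\<forall>u. \<exists>v. R (x, y) u v)"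
proof -
  from assms(1) obtain A where A: "computable (\<lambda>z. A (fst z) (snd z))"
      "\<And>x s. real (A x s) / Suc s \<le> U x" "\<And>x. (\<lambda>s. real (A x s) / Suc s) \<longlonglongrightarrow> U x"
    by (rule lscE) blast
  \<comment> \<open>\<open>u\<close> packs \<open>(k, d, c, s)\<close> and \<open>v\<close> packs
    \<open>(k', s')\<close>; the inequalities between fractions are cross-multiplied into
    inequalities between naturals.\<close>
  define R where "R p u v = (
    fst (snd (snd u)) * Suc (snd (snd (snd u))) <
      A (fst p, fst u) (snd (snd (snd u))) * Suc (fst (snd u)) \<longrightarrow>
    fst (snd (snd u)) * Suc (snd v) < A (snd p, fst v) (snd v) * Suc (fst (snd u)))"
    for p :: "'x \<times> 'x" and u :: "'k \<times> nat \<times> nat \<times> nat" and v :: "'k \<times> nat"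
  have R: "R (x, y) (k, d, c, s) (k', s') \<longleftrightarrow>
    (c / Suc d < A (x, k) s / Suc s \<longrightarrow> c / Suc d < A (y, k') s' / Suc s')" for x y k d c s k' s'
  proof -
    have "c * Suc s < a * Suc d \<longleftrightarrow> real c / Suc d < real a / Suc s" for a s
    proof -
      have "real c / Suc d < real a / Suc s \<longleftrightarrow> real c * Suc s < real a * Suc d"
        by (simp add: divide_less_eq less_divide_eq del: of_nat_Suc)
      also have "\<dots> \<longleftrightarrow> c * Suc s < a * Suc d"
        unfolding of_nat_mult[symmetric] of_nat_less_iff ..
      finally show ?thesis by simp
    qed
    then show ?thesis unfolding R_def by simp
  qed
  have less: "\<exists>s. b < A x s / Suc s" if "b < U x" for b x
    using order_tendstoD(1)[OF A(3) that] by (auto dest: eventually_happens)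
  have "decidable (\<lambda>z. R (fst z) (fst (snd z)) (snd (snd z)))"
    unfolding R_def
    by (intro computable_intros computable_comp[OF A(1), of "\<lambda>z. (g z, h z)" for g h, simplified])
  moreover have "(SUP k. U (x, k)) \<le> (SUP k. U (y, k)) \<longleftrightarrow> (\<forall>u. \<exists>v. R (x, y) u v)" (is "?L \<longleftrightarrow> ?R") for x y
  proof
    assume L: ?L
    show ?R
    proof
      fix u :: "'k \<times> nat \<times> nat \<times> nat"
      obtain k d c s where u: "u = (k, d, c, s)" by (cases u) auto
      show "\<exists>v. R (x, y) u v"
      proof (cases "c / Suc d < A (x, k) s / Suc s")
        case True
        have "c / Suc d < A (x, k) s / Suc s" by fact
        also have "\<dots> \<le> U (x, k)" by (rule A)
        also have "\<dots> \<le> (SUP k. U (x, k))" by (intro cSUP_upper bdd UNIV_I)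
        also note L
        finally obtain k' where "c / Suc d < U (y, k')"
          using less_cSUP_iff[OF _ bdd[of y]] by auto
        then show ?thesis using less R unfolding u by blast
      next
        case False
        then show ?thesis using R unfolding u by blast
      qed
    qed
  next
    assume R': ?R
    show ?L
    proof (rule ccontr)
      assume "\<not> ?L"
      then obtain k where "(SUP k. U (y, k)) < U (x, k)"
        using less_cSUP_iff[OF _ bdd[of x]] by (auto simp: not_le)
      then obtain s where "(SUP k. U (y, k)) < A (x, k) s / Suc s"
        using less by blast
      \<comment> \<open>The separating fraction has to be a quotient of naturals, which
        \<open>nonneg_fraction_dense\<close> provides above a nonnegative number.\<close>
      moreover have "0 \<le> (SUP k. U (y, k))"
        using lsc_nonneg[OF assms(1)] bdd by (meson UNIV_I cSUP_upper2)
      ultimately obtain c d :: nat where cd: "(SUP k. U (y, k)) < c / Suc d" "c / Suc d < A (x, k) s / Suc s"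
        using nonneg_fraction_dense by blast
      then obtain k' s' where "c / Suc d < A (y, k') s' / Suc s'"
        using R'[rule_format, of "(k, d, c, s)"] R by auto
      also have "\<dots> \<le> U (y, k')" by (rule A)
      also have "\<dots> \<le> (SUP k. U (y, k))" by (intro cSUP_upper bdd UNIV_I)
      finally show False using cd by simp
    qed
  qed
  ultimately show thesis by (rule that)
qed

section \<open>The third level of the arithmetical hierarchy\<close>

lemma bij_enc: "bij enc"
  by (rule bijI') (simp, metis enc_dec)

lemma ex_dec: "(\<exists>n. P (dec n :: 'a::coded)) \<longleftrightarrow> (\<exists>a. P a)"
  and all_dec: "(\<forall>n. P (dec n :: 'a::coded)) \<longleftrightarrow> (\<forall>a. P a)"
  by (metis dec_enc)+

text \<open>\<open>alternating\<close> appends each quantified number to the argument list, so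
  \<open>xs ! 0\<close> is the element and \<open>xs ! 1\<close> to \<open>xs ! 3\<close> are the
  bound variables from the outside in.\<close>

lemma Sigma0_3I:
  fixes R :: "'x::coded \<Rightarrow> 'a::coded \<Rightarrow> 'b::coded \<Rightarrow> 'c::coded \<Rightarrow> bool"
  assumes "decidable (\<lambda>z. R (fst z) (fst (snd z)) (fst (snd (snd z))) (snd (snd (snd z))))"
  shows "Sigma0 3 (enc ` {x. \<exists>a. \<forall>b. \<exists>c. R x a b c})"
proof -
  let ?R = "\<lambda>xs. R (dec (xs ! 0)) (dec (xs ! 1)) (dec (xs ! 2)) (dec (xs ! 3))"
  let ?D = "\<lambda>z. R (fst z) (fst (snd z)) (fst (snd (snd z))) (snd (snd (snd z)))"
  have "recursive 1 (\<lambda>xs. (\<lambda>n. of_bool (?D (dec n))) (xs ! 0))"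
    using assms by (simp add: computable_def enc_nat_def)
  moreover have "recursive 4 (\<lambda>xs. prod_encode (xs ! 0, prod_encode (xs ! 1, prod_encode (xs ! 2, xs ! 3))))"
    by (intro recursive_prod_encode recursive.proj) simp_all
  ultimately have "recursive 4 (\<lambda>xs. (\<lambda>n. of_bool (?D (dec n)))
      (prod_encode (xs ! 0, prod_encode (xs ! 1, prod_encode (xs ! 2, xs ! 3)))))"
    by (rule recursive_comp1)
  then have "recursive_rel (Suc 3) ?R"
    by (simp add: recursive_rel_def dec_prod_def)
  moreover have "enc ` {x. \<exists>a. \<forall>b. \<exists>c. R x a b c} = {x. alternating True 3 ?R [x]}"
  proof -
    have alt: "alternating True 3 ?R [x] \<longleftrightarrow> (\<exists>a. \<forall>b. \<exists>c. R (dec x) a b c)" for x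
      by (simp add: numeral_3_eq_3 numeral_2_eq_2 ex_dec[of "\<lambda>c. R u a b c" for u a b]
        all_dec[of "\<lambda>b. \<exists>c. R u a b c" for u a] ex_dec[of "\<lambda>a. \<forall>b. \<exists>c. R u a b c" for u])
    have enc_image: "x \<in> enc ` B \<longleftrightarrow> dec x \<in> B" for x and B :: "'x set"
      by (metis dec_enc enc_dec image_iff)
    show ?thesis by (intro set_eqI) (simp only: mem_Collect_eq alt enc_image)
  qed
  ultimately show ?thesis unfolding Sigma0_def by blast
qed

text \<open>Refuting the forall-exists property for all \<open>b < a\<close> needs one
  counterexample \<open>u\<close> per \<open>b\<close>. These finitely many fit into a list, which
  becomes the single outer existential quantifier. As the least value exists throughout
  \<open>V\<close>, the complement has the same form: \<open>a\<close> is wrong iff some other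
  \<open>b\<close> is right.\<close>

lemma Delta0_3_least:
  fixes W :: "'h::coded \<Rightarrow> nat \<Rightarrow> 'u::coded \<Rightarrow> 'v::coded \<Rightarrow> bool"
  assumes W: "decidable (\<lambda>z. W (fst z) (fst (snd z)) (fst (snd (snd z))) (snd (snd (snd z))))"
    and V: "decidable V"
    and ex: "\<And>h. V h \<Longrightarrow> \<exists>a. \<forall>u. \<exists>v. W h a u v"
  shows "Delta0 3 (enc ` {(h, a). V h \<and> a = (LEAST a. \<forall>u. \<exists>v. W h a u v)})" (is "Delta0 3 (enc ` ?S)")
proof -
  define P where "P h a \<longleftrightarrow> (\<forall>u. \<exists>v. W h a u v)" for h a
  \<comment> \<open>In \<open>p = (u, v')\<close>, \<open>u\<close> challenges \<open>W h a\<close>,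
    and \<open>v'\<close> challenges the refutations of all \<open>b < a\<close> at once;
    \<open>us\<close> holds the refuting value for each \<open>b\<close>.\<close>
  define T where "T h a us p v \<longleftrightarrow> W h a (fst p) v \<and> (\<forall>b<a. \<not> W h b (nthd us b) (snd p))"
    for h a and us :: "'u list" and p :: "'u \<times> 'v" and v
  note Wc = computable_comp[OF W, of "\<lambda>z. (f z, g z, h z, k z)" for f g h k, simplified]
  have T: "(\<exists>us. \<forall>p. \<exists>v. T h a us p v) \<longleftrightarrow> a = (LEAST a. P h a)" if "V h" for h a
  proof
    assume "\<exists>us. \<forall>p. \<exists>v. T h a us p v"
    then obtain us where us: "\<And>u v'. \<exists>v. W h a u v \<and> (\<forall>b<a. \<not> W h b (nthd us b) v')"
      unfolding T_def by auto
    then have "P h a" "\<And>b. b < a \<Longrightarrow> \<not> P h b"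
      unfolding P_def by blast+
    then show "a = (LEAST a. P h a)"
      by (metis LeastI Least_le le_neq_implies_less)
  next
    assume a: "a = (LEAST a. P h a)"
    have "\<exists>a. P h a" using ex[OF that] unfolding P_def .
    then have "P h a" unfolding a by (rule LeastI_ex)
    have "\<forall>b. \<exists>u. b < a \<longrightarrow> (\<forall>v. \<not> W h b u v)"
      using not_less_Least[of _ "P h"] unfolding a P_def by blast
    then obtain f where f: "\<And>b v. b < a \<Longrightarrow> \<not> W h b (f b) v"
      by metis
    have "\<forall>p. \<exists>v. T h a (map f [0..<a]) p v"
      using \<open>P h a\<close> f unfolding T_def P_def by (auto simp: nthd_def)
    then show "\<exists>us. \<forall>p. \<exists>v. T h a us p v" ..
  qed
  have s1: "Sigma0 3 (enc ` {x. \<exists>us. \<forall>p. \<exists>v. V (fst x) \<and> T (fst x) (snd x) us p v})"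
    unfolding T_def by (intro Sigma0_3I computable_intros Wc computable_comp[OF V])
  have e1: "{x. \<exists>us. \<forall>p. \<exists>v. V (fst x) \<and> T (fst x) (snd x) us p v} = ?S"
  proof -
    have "(\<exists>us. \<forall>p. \<exists>v. V h \<and> T h a us p v) \<longleftrightarrow> V h \<and> a = (LEAST a. P h a)" for h a
      using T[of h a] by blast
    then show ?thesis unfolding P_def
      by (intro set_eqI) (simp only: mem_Collect_eq case_prod_unfold)
  qed
  \<comment> \<open>\<open>q\<close> pairs the correct value with its list of counterexamples;
    outside \<open>V\<close> nothing has to be checked.\<close>
  have s2: "Sigma0 3 (enc ` {x. \<exists>q. \<forall>p. \<exists>v. \<not> V (fst x) \<or> fst q \<noteq> snd x \<and> T (fst x) (fst q) (snd q) p v})"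
    unfolding T_def by (intro Sigma0_3I computable_intros Wc computable_comp[OF V])
  have e2: "{x. \<exists>q. \<forall>p. \<exists>v. \<not> V (fst x) \<or> fst q \<noteq> snd x \<and> T (fst x) (fst q) (snd q) p v} = - ?S"
  proof -
    have eq: "(\<exists>q. \<forall>p. \<exists>v. \<not> V h \<or> fst q \<noteq> a \<and> T h (fst q) (snd q) p v) \<longleftrightarrow>
        \<not> V h \<or> (\<exists>b. b \<noteq> a \<and> (\<exists>us. \<forall>p. \<exists>v. T h b us p v))" for h a
      unfolding split_paired_Ex by auto
    have "(\<exists>q. \<forall>p. \<exists>v. \<not> V h \<or> fst q \<noteq> a \<and> T h (fst q) (snd q) p v) \<longleftrightarrow>
        \<not> (V h \<and> a = (LEAST a. P h a))" for h a
    proof (cases "V h")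
      case True
      show ?thesis unfolding eq T[OF True] using True by auto
    qed (auto simp: eq)
    then show ?thesis unfolding P_def
      by (intro set_eqI) (simp only: mem_Collect_eq case_prod_unfold Compl_iff)
  qed
  have "- enc ` ?S = enc ` (- ?S)"
    by (rule bij_image_Compl_eq[symmetric, OF bij_enc])
  then show ?thesis
    using s1[unfolded e1] s2[unfolded e2] unfolding Delta0_def Pi0_def by simp
qed

section \<open>Optimality of greedy policies\<close>

lemma histories_iff: "h \<in> histories E \<longleftrightarrow> map snd h \<in> lists E"
  unfolding histories_def by (induction h) auto

lemma continue_append: "continue \<pi> h (es @ fs) = continue \<pi> (continue \<pi> h es) fs"
  by (induction es arbitrary: h) auto

lemma length_continue [simp]: "length (continue \<pi> h es) = length h + length es"
  by (induction es arbitrary: h) auto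

lemma map_snd_continue: "map snd (continue \<pi> h es) = map snd h @ es"
  by (induction es arbitrary: h) auto

lemma snd_last_continue: "es \<noteq> [] \<Longrightarrow> snd (last (continue \<pi> h es)) = last es"
  by (cases es rule: rev_cases) (auto simp: continue_append)

lemma inj_continue: "inj (continue \<pi> h)"
  by (rule injI) (metis map_snd_continue same_append_eq)

lemma continue_in_histories:
  "h \<in> histories E \<Longrightarrow> es \<in> lists E \<Longrightarrow> continue \<pi> h es \<in> histories E"
  by (simp add: histories_iff map_snd_continue)

lemma take_continue: "take (length h) (continue \<pi> h es) = h"
  by (induction es rule: rev_induct) (auto simp: continue_append)

lemma fst_nth_continue:
  "length h \<le> i \<Longrightarrow> i < length h + length es \<Longrightarrow>
    fst (continue \<pi> h es ! i) = \<pi> (take i (continue \<pi> h es))"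
proof (induction es rule: rev_induct)
  case (snoc e es)
  then show ?case
    by (cases "i = length h + length es") (auto simp: continue_append nth_append)
qed simp

text \<open>Converse to \<open>take_continue\<close> and \<open>fst_nth_continue\<close>:
  continuations are recognised by their prefix and their later actions, the form in which codes are
  checked against a policy table below.\<close>

lemma eq_continueI:
  assumes "length h \<le> length y" "take (length h) y = h"
    and "\<And>i. length h \<le> i \<Longrightarrow> i < length y \<Longrightarrow> fst (y ! i) = \<pi> (take i y)"
  shows "y = continue \<pi> h (map snd (drop (length h) y))"
  using assms
proof (induction y rule: rev_induct)
  case (snoc x y)
  show ?case
  proof (cases "length h \<le> length y")
    case True
    have "y = continue \<pi> h (map snd (drop (length h) y))"
    proof (rule snoc.IH)
      show "fst (y ! i) = \<pi> (take i y)" if "length h \<le> i" "i < length y" for i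
        using snoc.prems(3)[of i] that by (simp add: nth_append)
    qed (use True snoc.prems(2) in auto)
    moreover have "fst x = \<pi> y"
      using snoc.prems(3)[of "length y"] True by simp
    ultimately show ?thesis
      using True by (simp add: continue_append prod_eq_iff)
  next
    case False
    then have "length h = length (y @ [x])" using snoc.prems(1) by simp
    then show ?thesis using snoc.prems(2) by simp
  qed
qed simp

definition words :: "'x set \<Rightarrow> nat \<Rightarrow> 'x list set" where
  "words S n = {xs. xs \<in> lists S \<and> length xs = n}"

lemma words_0 [simp]: "words S 0 = {[]}"
  by (auto simp: words_def)

lemma finite_words: "finite S \<Longrightarrow> finite (words S n)"
  using finite_lists_length_eq[of S n] by (simp add: words_def lists_eq_set)

lemma sum_words_Suc:
  assumes "finite S"
  shows "(\<Sum>xs\<in>words S (Suc n). f xs) = (\<Sum>x\<in>S. \<Sum>xs\<in>words S n. f (x # xs))"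
proof -
  have "words S (Suc n) = case_prod (#) ` (S \<times> words S n)"
    by (auto simp: words_def length_Suc_conv image_iff)
  moreover have "inj_on (case_prod (#)) (S \<times> words S n)"
    by (auto simp: inj_on_def)
  ultimately have "(\<Sum>xs\<in>words S (Suc n). f xs) = (\<Sum>(x, xs)\<in>S \<times> words S n. f (x # xs))"
    by (simp add: sum.reindex case_prod_unfold)
  then show ?thesis by (simp add: sum.cartesian_product)
qed

section \<open>Unnormalised gains and the greedy policy\<close>

locale discounted_environment =
  fixes E :: "'o percept set" and \<gamma> :: "nat \<Rightarrow> real" and \<nu> :: "('a, 'o) environment"
  assumes finite_E: "finite E"
    and reward_E: "\<And>e. e \<in> E \<Longrightarrow> 0 \<le> reward e" "\<And>e. e \<in> E \<Longrightarrow> reward e \<le> 1"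
    and \<gamma>_nonneg: "\<And>k. 0 \<le> \<gamma> k"
    and summable_\<gamma>: "summable \<gamma>"
    and semimeasure: "chronological_semimeasure E \<nu>"
begin

abbreviation prob :: "('a, 'o) history \<Rightarrow> real" where
  "prob \<equiv> hist_prob \<nu>"

text \<open>One summand of the value without its normalisation, attributed to the history that ends
  with the rewarded percept. As time starts at 1, this percept arrives at time
  \<open>length h\<close>.\<close>

definition gain :: "('a, 'o) history \<Rightarrow> real" where
  "gain h = \<gamma> (length h) * (reward (snd (last h)) * prob h)"

definition level_gain :: "('a, 'o) policy \<Rightarrow> ('a, 'o) history \<Rightarrow> nat \<Rightarrow> real" where
  "level_gain \<pi> h j = (\<Sum>es\<in>words E (Suc j). gain (continue \<pi> h es))"

definition total_gain :: "('a, 'o) policy \<Rightarrow> ('a, 'o) history \<Rightarrow> real" where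
  "total_gain \<pi> h = (\<Sum>j. level_gain \<pi> h j)"

text \<open>This is the \<open>Q\<close> of the overview.\<close>

definition action_gain :: "('a, 'o) history \<Rightarrow> 'a \<Rightarrow> real" where
  "action_gain h a = (SUP \<pi>\<in>{\<pi>. \<pi> h = a}. total_gain \<pi> h)"

lemma env_domain_history: "h \<in> histories E \<Longrightarrow> (map snd h, map fst h) \<in> env_domain E"
  by (auto simp: env_domain_def histories_iff)

lemma prob_nonneg: "h \<in> histories E \<Longrightarrow> 0 \<le> prob h"
  using semimeasure env_domain_history[of h]
  unfolding chronological_semimeasure_def hist_prob_def by fast

lemma sum_prob_step:
  assumes "h \<in> histories E"
  shows "(\<Sum>e\<in>E. prob (h @ [(a, e)])) \<le> prob h"
  using semimeasure env_domain_history[OF assms]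
  unfolding chronological_semimeasure_def hist_prob_def map_append list.map fst_conv snd_conv
  by fast

lemma snoc_in_histories: "h \<in> histories E \<Longrightarrow> e \<in> E \<Longrightarrow> h @ [(a, e)] \<in> histories E"
  by (auto simp: histories_iff)

text \<open>Iterates the one-step semimeasure inequality along the policy: probability mass may be
  lost but never gained.\<close>

lemma sum_prob_words:
  "h \<in> histories E \<Longrightarrow> (\<Sum>es\<in>words E n. prob (continue \<pi> h es)) \<le> prob h"
proof (induction n arbitrary: h)
  case (Suc n)
  have "(\<Sum>es\<in>words E (Suc n). prob (continue \<pi> h es)) =
      (\<Sum>e\<in>E. \<Sum>es\<in>words E n. prob (continue \<pi> (h @ [(\<pi> h, e)]) es))"
    by (simp add: sum_words_Suc finite_E)
  also have "\<dots> \<le> (\<Sum>e\<in>E. prob (h @ [(\<pi> h, e)]))"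
    by (intro sum_mono Suc.IH snoc_in_histories Suc.prems)
  also have "\<dots> \<le> prob h" by (rule sum_prob_step) fact
  finally show ?case .
qed simp

lemma gain_nonneg:
  assumes "h \<in> histories E" "h \<noteq> []"
  shows "0 \<le> gain h"
proof -
  have "snd (last h) \<in> E"
    using assms last_in_set[of "map snd h"] by (auto simp: histories_iff last_map)
  then show ?thesis
    unfolding gain_def using reward_E prob_nonneg[OF assms(1)] \<gamma>_nonneg by simp
qed

lemma gain_continue_nonneg:
  assumes "h \<in> histories E" "es \<in> lists E" "es \<noteq> []"
  shows "0 \<le> gain (continue \<pi> h es)"
  using assms by (intro gain_nonneg continue_in_histories) (auto dest: arg_cong[of _ _ length])

lemma level_gain_nonneg: "h \<in> histories E \<Longrightarrow> 0 \<le> level_gain \<pi> h j"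
  unfolding level_gain_def by (intro sum_nonneg gain_continue_nonneg) (auto simp: words_def)

lemma level_gain_le:
  assumes "h \<in> histories E"
  shows "level_gain \<pi> h j \<le> \<gamma> (Suc (length h) + j) * prob h"
proof -
  have "level_gain \<pi> h j \<le> (\<Sum>es\<in>words E (Suc j). \<gamma> (Suc (length h) + j) * prob (continue \<pi> h es))"
    unfolding level_gain_def
  proof (rule sum_mono)
    fix es assume es: "es \<in> words E (Suc j)"
    then have "es \<noteq> []" "es \<in> lists E" by (auto simp: words_def)
    then have "reward (last es) * prob (continue \<pi> h es) \<le> 1 * prob (continue \<pi> h es)"
      using assms by (intro mult_right_mono reward_E prob_nonneg continue_in_histories)
        (auto dest: last_in_set)
    then show "gain (continue \<pi> h es) \<le> \<gamma> (Suc (length h) + j) * prob (continue \<pi> h es)"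
      using es \<open>es \<noteq> []\<close>
      by (auto simp: gain_def words_def snd_last_continue \<gamma>_nonneg intro!: mult_left_mono)
  qed
  also have "\<dots> = \<gamma> (Suc (length h) + j) * (\<Sum>es\<in>words E (Suc j). prob (continue \<pi> h es))"
    by (simp add: sum_distrib_left)
  also have "\<dots> \<le> \<gamma> (Suc (length h) + j) * prob h"
    by (intro mult_left_mono sum_prob_words assms \<gamma>_nonneg)
  finally show ?thesis .
qed

lemma summable_\<gamma>_shift: "summable (\<lambda>j. \<gamma> (t + j))"
  using summable_ignore_initial_segment[OF summable_\<gamma>, of t] by (simp add: add.commute)

lemma summable_level_gain:
  assumes "h \<in> histories E"
  shows "summable (level_gain \<pi> h)"
proof (rule summable_comparison_test')
  show "summable (\<lambda>j. \<gamma> (Suc (length h) + j) * prob h)"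
    by (intro summable_mult2 summable_\<gamma>_shift)
qed (use level_gain_le[OF assms] level_gain_nonneg[OF assms] in auto)

lemma total_gain_nonneg: "h \<in> histories E \<Longrightarrow> 0 \<le> total_gain \<pi> h"
  unfolding total_gain_def by (intro suminf_nonneg summable_level_gain level_gain_nonneg)

lemma total_gain_le:
  assumes "h \<in> histories E"
  shows "total_gain \<pi> h \<le> prob h * discount_tail \<gamma> (Suc (length h))"
proof -
  have "total_gain \<pi> h \<le> (\<Sum>j. \<gamma> (Suc (length h) + j) * prob h)"
    unfolding total_gain_def
    by (intro suminf_le level_gain_le summable_level_gain summable_mult2 summable_\<gamma>_shift assms)
  also have "\<dots> = (\<Sum>j. \<gamma> (Suc (length h) + j)) * prob h"
    by (rule suminf_mult2[symmetric]) (rule summable_\<gamma>_shift)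
  finally show ?thesis by (simp add: discount_tail_def mult.commute)
qed

text \<open>The Bellman equation of a fixed policy: level 0 holds the immediate gains, and the
  higher levels regroup by the first percept. The series and the finite sum over \<open>E\<close>
  can be exchanged.\<close>

lemma total_gain_unfold:
  assumes "h \<in> histories E"
  shows "total_gain \<pi> h =
    (\<Sum>e\<in>E. gain (h @ [(\<pi> h, e)]) + total_gain \<pi> (h @ [(\<pi> h, e)]))"
proof -
  have 0: "level_gain \<pi> h 0 = (\<Sum>e\<in>E. gain (h @ [(\<pi> h, e)]))"
    by (simp add: level_gain_def sum_words_Suc finite_E)
  have Suc: "level_gain \<pi> h (Suc j) = (\<Sum>e\<in>E. level_gain \<pi> (h @ [(\<pi> h, e)]) j)" for j
    unfolding level_gain_def by (subst sum_words_Suc) (simp_all add: finite_E)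
  have "total_gain \<pi> h = (\<Sum>j. level_gain \<pi> h (Suc j)) + level_gain \<pi> h 0"
    unfolding total_gain_def using suminf_split_head[OF summable_level_gain[OF assms]] by simp
  also have "(\<Sum>j. level_gain \<pi> h (Suc j)) = (\<Sum>e\<in>E. total_gain \<pi> (h @ [(\<pi> h, e)]))"
    unfolding Suc total_gain_def
    by (rule suminf_sum) (intro summable_level_gain snoc_in_histories assms)
  finally show ?thesis by (simp add: 0 sum.distrib)
qed

lemma bdd_above_total_gain: "h \<in> histories E \<Longrightarrow> bdd_above ((\<lambda>\<pi>. total_gain \<pi> h) ` P)"
  by (rule bdd_aboveI2) (rule total_gain_le)

lemma total_gain_le_action_gain:
  "h \<in> histories E \<Longrightarrow> total_gain \<pi> h \<le> action_gain h (\<pi> h)"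
  unfolding action_gain_def by (intro cSUP_upper bdd_above_total_gain) auto

lemma discount_tail_tendsto_0: "(\<lambda>n. discount_tail \<gamma> (t + n)) \<longlonglongrightarrow> 0"
proof -
  have "discount_tail \<gamma> = (\<lambda>n. suminf \<gamma> - (\<Sum>k<n. \<gamma> k))"
    unfolding discount_tail_def
    using suminf_minus_initial_segment[OF summable_\<gamma>] by (simp add: add.commute)
  moreover have "(\<lambda>n. suminf \<gamma> - (\<Sum>k<n. \<gamma> k)) \<longlonglongrightarrow> suminf \<gamma> - suminf \<gamma>"
    by (intro tendsto_intros summable_LIMSEQ summable_\<gamma>)
  ultimately have "discount_tail \<gamma> \<longlonglongrightarrow> 0" by simp
  from LIMSEQ_ignore_initial_segment[OF this, of t] show ?thesis by (simp add: add.commute)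
qed

text \<open>Following the greedy policy for \<open>n\<close> steps loses nothing, and what can be lost afterwards is
  bounded by the remaining discount.\<close>

lemma greedy_total_gain_aux:
  assumes greedy: "\<And>h a. h \<in> histories E \<Longrightarrow> action_gain h a \<le> action_gain h (g h)"
    and "h \<in> histories E"
  shows "total_gain \<pi> h \<le> total_gain g h + prob h * discount_tail \<gamma> (Suc (length h) + n)"
  using assms(2)
proof (induction n arbitrary: h \<pi>)
  case 0
  then show ?case using total_gain_le[of h \<pi>] total_gain_nonneg[of h g] by simp
next
  case (Suc n)
  note h = \<open>h \<in> histories E\<close>
  let ?T = "discount_tail \<gamma> (Suc (length h) + Suc n)"
  let ?h = "\<lambda>e. h @ [(g h, e)]"
  have "total_gain \<pi> h \<le> action_gain h (g h)"
    using total_gain_le_action_gain[OF h] greedy[OF h] by (rule order_trans)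
  also have "\<dots> \<le> total_gain g h + prob h * ?T"
    unfolding action_gain_def
  proof (rule cSUP_least)
    show "{\<pi>. \<pi> h = g h} \<noteq> {}" by auto
    fix \<pi>' assume "\<pi>' \<in> {\<pi>. \<pi> h = g h}"
    then have "\<pi>' h = g h" by simp
    \<comment> \<open>Every competitor now takes the action of \<open>g\<close> at \<open>h\<close>,
      so both one-step expansions have the same immediate gains. At the longer history the induction
      hypothesis again ends in \<open>?T\<close>: one step of \<open>n\<close> is traded for one of
      length.\<close>
    then have "total_gain \<pi>' h = (\<Sum>e\<in>E. gain (?h e) + total_gain \<pi>' (?h e))"
      using total_gain_unfold[OF h] by simp
    also have "\<dots> \<le> (\<Sum>e\<in>E. gain (?h e) + (total_gain g (?h e) + prob (?h e) * ?T))"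
      using Suc.IH[OF snoc_in_histories[OF h]] by (intro sum_mono add_left_mono) simp
    also have "\<dots> = total_gain g h + (\<Sum>e\<in>E. prob (?h e)) * ?T"
      using total_gain_unfold[OF h, of g] by (simp add: sum.distrib sum_distrib_right)
    also have "\<dots> \<le> total_gain g h + prob h * ?T"
      unfolding discount_tail_def
      by (intro add_left_mono mult_right_mono sum_prob_step h suminf_nonneg summable_\<gamma>_shift \<gamma>_nonneg)
    finally show "total_gain \<pi>' h \<le> total_gain g h + prob h * ?T" .
  qed
  finally show ?case .
qed

lemma greedy_total_gain:
  assumes greedy: "\<And>h a. h \<in> histories E \<Longrightarrow> action_gain h a \<le> action_gain h (g h)"
    and "h \<in> histories E"
  shows "total_gain \<pi> h \<le> total_gain g h"
proof (rule LIMSEQ_le_const)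
  have "(\<lambda>n. total_gain g h + prob h * discount_tail \<gamma> (Suc (length h) + n))
      \<longlonglongrightarrow> total_gain g h + prob h * 0"
    by (intro tendsto_intros discount_tail_tendsto_0)
  then show "(\<lambda>n. total_gain g h + prob h * discount_tail \<gamma> (Suc (length h) + n)) \<longlonglongrightarrow> total_gain g h"
    by simp
qed (use greedy_total_gain_aux[OF assms] in blast)

text \<open>The constant factors leave the inner sum and the series. For \<open>prob h = 0\<close>
  both sides are 0 by the convention on division, so the equation needs no case distinction
  there.\<close>

lemma policy_value_eq:
  "policy_value E \<gamma> \<nu> \<pi> h = (if discount_tail \<gamma> (Suc (length h)) > 0
    then total_gain \<pi> h / (discount_tail \<gamma> (Suc (length h)) * prob h) else 0)" if "h \<in> histories E"
proof -
  have "\<gamma> (Suc (length h) + j) *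
      (\<Sum>es | es \<in> lists E \<and> length es = Suc j. reward (last es) * (prob (continue \<pi> h es) / prob h)) =
      level_gain \<pi> h j / prob h" for j
    unfolding level_gain_def sum_distrib_left sum_divide_distrib words_def[symmetric]
  proof (rule sum.cong)
    fix es assume "es \<in> words E (Suc j)"
    then have "es \<noteq> []" "length es = Suc j" by (auto simp: words_def)
    then show "\<gamma> (Suc (length h) + j) * (reward (last es) * (prob (continue \<pi> h es) / prob h)) =
        gain (continue \<pi> h es) / prob h"
      by (simp add: gain_def snd_last_continue)
  qed simp
  then show ?thesis
    unfolding policy_value_def Let_def total_gain_def
    using suminf_divide[OF summable_level_gain[OF that], of \<pi> "prob h"] by (simp add: divide_inverse)
qed

lemma greedy_optimal:
  assumes greedy: "\<And>h a. h \<in> histories E \<Longrightarrow> action_gain h a \<le> action_gain h (g h)"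
  shows "optimal_policy E \<gamma> \<nu> g"
  unfolding optimal_policy_def optimal_value_def
proof (intro ballI impI)
  fix h assume h: "h \<in> histories E" "prob h > 0"
  have "policy_value E \<gamma> \<nu> \<pi> h \<le> policy_value E \<gamma> \<nu> g h" for \<pi>
    using greedy_total_gain[OF greedy h(1), of \<pi>] h
    by (auto simp: policy_value_eq intro!: divide_right_mono)
  then show "policy_value E \<gamma> \<nu> g h = (SUP \<pi>. policy_value E \<gamma> \<nu> \<pi> h)"
    by (intro cSup_eq_maximum[symmetric]) auto
qed

section \<open>Total gain as the supremum of finite sums of gains\<close>

definition extensions :: "('a, 'o) policy \<Rightarrow> ('a, 'o) history \<Rightarrow> nat \<Rightarrow> ('a, 'o) history set" where
  "extensions \<pi> h n = continue \<pi> h ` (\<Union>j<n. words E (Suc j))"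

lemma finite_extensions: "finite (extensions \<pi> h n)"
  unfolding extensions_def by (intro finite_imageI finite_UN_I finite_words finite_E) simp

lemma sum_extensions: "(\<Sum>y\<in>extensions \<pi> h n. gain y) = (\<Sum>j<n. level_gain \<pi> h j)"
  unfolding extensions_def level_gain_def
  by (subst sum.reindex[OF inj_on_subset[OF inj_continue subset_UNIV]], subst sum.UNION_disjoint)
     (auto simp: finite_words finite_E, auto simp: words_def)

text \<open>A finite set of continuations has bounded length and so lies in some
  \<open>extensions \<pi> h n\<close>. The terms added are nonnegative, and the larger sum is a
  partial sum of the series.\<close>

lemma sum_gain_le_total_gain:
  assumes h: "h \<in> histories E" and "finite Y"
    and Y: "\<And>y. y \<in> Y \<Longrightarrow> \<exists>es\<in>lists E. es \<noteq> [] \<and> y = continue \<pi> h es"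
  shows "(\<Sum>y\<in>Y. gain y) \<le> total_gain \<pi> h"
proof -
  from \<open>finite Y\<close> obtain n where n: "\<And>y. y \<in> Y \<Longrightarrow> length y < n"
    using finite_nat_set_iff_bounded[of "length ` Y"] by auto
  have "Y \<subseteq> extensions \<pi> h n"
  proof
    fix y assume y: "y \<in> Y"
    then obtain es where es: "es \<in> lists E" "es \<noteq> []" "y = continue \<pi> h es" using Y by blast
    then have "es \<in> words E (Suc (length es - 1))" "length es - 1 < n"
      using n[OF y] by (auto simp: words_def)
    then show "y \<in> extensions \<pi> h n"
      unfolding extensions_def es(3) by blast
  qed
  then have "(\<Sum>y\<in>Y. gain y) \<le> (\<Sum>y\<in>extensions \<pi> h n. gain y)"
    by (rule sum_mono2[OF finite_extensions])
       (auto simp: extensions_def words_def intro!: gain_continue_nonneg h)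
  also have "\<dots> \<le> total_gain \<pi> h"
    unfolding sum_extensions total_gain_def
    by (intro sum_le_suminf summable_level_gain level_gain_nonneg h) auto
  finally show ?thesis .
qed

lemma less_total_gainE:
  assumes "x < total_gain \<pi> h" "h \<in> histories E"
  obtains n where "x < (\<Sum>y\<in>extensions \<pi> h n. gain y)"
proof -
  have "\<forall>\<^sub>F n in sequentially. x < (\<Sum>j<n. level_gain \<pi> h j)"
    using order_tendstoD(1)[OF summable_LIMSEQ[OF summable_level_gain[OF assms(2)]]] assms(1)
    unfolding total_gain_def by blast
  then show thesis
    using that unfolding sum_extensions by (auto dest: eventually_happens)
qed

end

section \<open>Semicomputability of the optimal gain\<close>

lemma to_nat_on_less_card: "finite S \<Longrightarrow> x \<in> S \<Longrightarrow> to_nat_on S x < card S"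
  using bij_betwE[OF to_nat_on_finite] by blast

lemma from_nat_into_finite:
  assumes "finite S" "n < card S"
  shows "to_nat_on S (from_nat_into S n) = n" "from_nat_into S n \<in> S"
proof -
  have "n \<in> to_nat_on S ` S"
    using bij_betw_imp_surj_on[OF to_nat_on_finite[OF assms(1)]] assms(2) by simp
  then show "to_nat_on S (from_nat_into S n) = n" by (rule to_nat_on_from_nat_into)
  have "S \<noteq> {}" using assms by auto
  then show "from_nat_into S n \<in> S" by (rule from_nat_into)
qed

section \<open>Codes of histories and finite policy tables\<close>

lemma snd_in_percepts: "h \<in> histories E \<Longrightarrow> p \<in> set h \<Longrightarrow> snd p \<in> E"
  unfolding histories_iff in_lists_conv_set set_map by blast

definition valid_code :: "nat \<Rightarrow> nat \<Rightarrow> (nat \<times> nat) list \<Rightarrow> bool" where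
  "valid_code n m z \<longleftrightarrow> (\<forall>i<length z. fst (nthd z i) < n \<and> snd (nthd z i) < m)"

lemma valid_code_iff: "valid_code n m z \<longleftrightarrow> (\<forall>p\<in>set z. fst p < n \<and> snd p < m)"
  by (auto simp: valid_code_def nthd_def all_set_conv_all_nth)

lemma decidable_valid_code [computable_intros]:
  "computable f \<Longrightarrow> decidable (\<lambda>x. valid_code n m (f x))"
  unfolding valid_code_def by (intro computable_intros computable_comp[OF _ computable_fst])

text \<open>Stops at lists of pairs of numbers, where the closure rules for computable functions
  operate; one application of \<open>enc\<close> then yields \<open>history_encode\<close>.\<close>

definition hist_code :: "'o percept set \<Rightarrow> ('a::finite, 'o) history \<Rightarrow> (nat \<times> nat) list" where
  "hist_code E h = map (map_prod (to_nat_on UNIV) (to_nat_on E)) h"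

definition hist_decode :: "'o percept set \<Rightarrow> (nat \<times> nat) list \<Rightarrow> ('a::finite, 'o) history" where
  "hist_decode E z = map (map_prod (from_nat_into UNIV) (from_nat_into E)) z"

lemma length_hist_code [simp]: "length (hist_code E h) = length h"
  by (simp add: hist_code_def)

lemma length_hist_decode [simp]: "length (hist_decode E z) = length z"
  by (simp add: hist_decode_def)

lemma take_hist_code: "take i (hist_code E h) = hist_code E (take i h)"
  by (simp add: hist_code_def take_map)

lemma take_hist_decode: "take i (hist_decode E z) = hist_decode E (take i z)"
  by (simp add: hist_decode_def take_map)

lemma history_encode_eq: "history_encode E h = enc (hist_code E h)"
  by (simp add: history_encode_def hist_code_def enc_list_def enc_prod_def enc_nat_def
      case_prod_unfold comp_def)

lemma valid_hist_code:
  fixes h :: "('a::finite, 'o) history"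
  assumes "finite E" "h \<in> histories E"
  shows "valid_code CARD('a) (card E) (hist_code E h)"
  using snd_in_percepts[OF assms(2)] assms(1)
  by (auto simp: valid_code_iff hist_code_def to_nat_on_less_card)

lemma hist_decode_code [simp]:
  assumes "finite E" "h \<in> histories E"
  shows "hist_decode E (hist_code E h) = h"
proof -
  have "map_prod (from_nat_into UNIV) (from_nat_into E)
      (map_prod (to_nat_on UNIV) (to_nat_on E) p) = p" if "p \<in> set h" for p
    using snd_in_percepts[OF assms(2) that] assms(1)
    by (simp add: prod_eq_iff countable_finite)
  then show ?thesis
    by (auto simp: hist_code_def hist_decode_def intro: map_idI)
qed

lemma
  fixes z :: "(nat \<times> nat) list"
  assumes "finite E" "valid_code CARD('a) (card E) z"
  shows hist_code_decode: "hist_code E (hist_decode E z :: ('a::finite, 'o) history) = z"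
    and hist_decode_in_histories: "(hist_decode E z :: ('a, 'o) history) \<in> histories E"
proof -
  have *: "fst p < CARD('a)" "snd p < card E" if "p \<in> set z" for p
    using assms(2) that by (auto simp: valid_code_iff)
  show "hist_code E (hist_decode E z :: ('a, 'o) history) = z"
    unfolding hist_code_def hist_decode_def map_map
    by (rule map_idI) (simp add: prod_eq_iff from_nat_into_finite assms(1) *)
  show "(hist_decode E z :: ('a, 'o) history) \<in> histories E"
    using * assms(1) unfolding hist_decode_def histories_iff in_lists_conv_set
    by (auto intro: from_nat_into_finite(2))
qed

text \<open>A finite policy table lists actions by the code of the history; the action at \<open>h\<close> is overridden.\<close>

definition table_action :: "(nat \<times> nat) list \<Rightarrow> nat \<Rightarrow> nat list \<Rightarrow> (nat \<times> nat) list \<Rightarrow> nat" where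
  "table_action h a \<sigma> z = (if z = h then a else nthd \<sigma> (enc z))"

text \<open>Tests whether \<open>z\<close> codes a proper continuation of \<open>h\<close> under the
  policy that plays \<open>a\<close> at \<open>h\<close> and follows the table elsewhere. Validity
  of \<open>h\<close> and \<open>a\<close> belongs to the test, so that meaningless arguments lead
  to zero sums. The prefix \<open>take i z\<close> is written as a tabulation to fit the
  computability rules.\<close>

definition consistent_code ::
  "nat \<Rightarrow> nat \<Rightarrow> (nat \<times> nat) list \<Rightarrow> nat \<Rightarrow> nat list \<Rightarrow> (nat \<times> nat) list \<Rightarrow> bool" where
  "consistent_code n m h a \<sigma> z \<longleftrightarrow> valid_code n m h \<and> a < n \<and> valid_code n m z \<and> length h < length z \<and>
    (\<forall>i<length z. (i < length h \<longrightarrow> nthd z i = nthd h i) \<and>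
      (length h \<le> i \<longrightarrow> fst (nthd z i) = table_action h a \<sigma> (map (nthd z) [0..<i])))"

lemma map_nthd_upt: "i \<le> length z \<Longrightarrow> map (nthd z) [0..<i] = take i z"
  by (rule nth_equalityI) (auto simp: nthd_def)

lemma consistent_code_iff:
  "consistent_code n m h a \<sigma> z \<longleftrightarrow> valid_code n m h \<and> a < n \<and> valid_code n m z \<and>
    length h < length z \<and> take (length h) z = h \<and>
    (\<forall>i. length h \<le> i \<longrightarrow> i < length z \<longrightarrow> fst (z ! i) = table_action h a \<sigma> (take i z))"
proof -
  have "length h < length z \<Longrightarrow> take (length h) z = h \<longleftrightarrow> (\<forall>i<length h. z ! i = h ! i)"
    by (auto simp: list_eq_iff_nth_eq)
  then show ?thesis
    unfolding consistent_code_def by (auto simp: nthd_def map_nthd_upt)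
qed

lemma decidable_consistent_code [computable_intros]:
  assumes "computable h" "computable a" "computable \<sigma>" "computable z"
  shows "decidable (\<lambda>x. consistent_code n m (h x) (a x) (\<sigma> x) (z x))"
  unfolding consistent_code_def table_action_def
  by (intro computable_intros assms computable_comp[OF assms(1) computable_fst]
      computable_comp[OF assms(2) computable_fst] computable_comp[OF assms(3) computable_fst]
      computable_comp[OF assms(4)])

section \<open>Approximating the optimal gain through policy tables\<close>

locale semicomputable_environment = discounted_environment E \<gamma> \<nu>
  for E :: "'o percept set" and \<gamma> :: "nat \<Rightarrow> real" and \<nu> :: "('a::finite, 'o) environment" +
  assumes reward_lsc: "lower_semicomputable_on (to_nat_on E) E reward"
    and \<gamma>_lsc: "lower_semicomputable_on id UNIV \<gamma>"
    and \<nu>_lsc: "lower_semicomputable_env E \<nu>"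
begin

text \<open>The empty code is treated like an invalid one because \<open>gain []\<close> would read
  the reward of the unspecified \<open>last []\<close>.\<close>

definition coded_gain :: "(nat \<times> nat) list \<Rightarrow> real" where
  "coded_gain z = (if valid_code CARD('a) (card E) z \<and> z \<noteq> [] then gain (hist_decode E z) else 0)"

lemma coded_gain_hist_code:
  "h \<in> histories E \<Longrightarrow> h \<noteq> [] \<Longrightarrow> coded_gain (hist_code E h) = gain h"
  unfolding coded_gain_def using valid_hist_code[OF finite_E, of h]
  by (simp add: finite_E) (simp add: hist_code_def)

text \<open>Reward, discount and environment are each moved to total functions on codes and then
  multiplied. Their arguments are read off the code: the percept number in its last entry, its
  length, and its two component lists.\<close>

lemma lsc_coded_gain: "lsc coded_gain"
proof -
  define r where "r j = (if j < card E then reward (from_nat_into E j) else 0)" for j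
  have "lsc r"
  proof (rule lsc_of_lower_semicomputable_on[OF reward_lsc])
    show "r (dec (to_nat_on E e)) = reward e" if "e \<in> E" for e
      using that to_nat_on_less_card[OF finite_E that] finite_E
      by (simp add: r_def dec_nat_def countable_finite)
    show "r y = 0" if "enc y \<notin> to_nat_on E ` E" for y
    proof -
      have "to_nat_on E ` E = {..<card E}"
        by (rule bij_betw_imp_surj_on[OF to_nat_on_finite[OF finite_E]])
      then show ?thesis using that by (simp add: r_def enc_nat_def)
    qed
    show "0 \<le> r y" for y
      unfolding r_def using reward_E from_nat_into_finite(2)[OF finite_E] by auto
  qed
  define v where "v p = (if enc p \<in> env_encode E ` (env_domain E :: ('o percept list \<times> 'a list) set)
    then \<nu> (map (from_nat_into E) (fst p)) (map (from_nat_into UNIV) (snd p)) else 0)"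
    for p :: "nat list \<times> nat list"
  have enc_env: "env_encode E (es, as) = enc (map (to_nat_on E) es, map (to_nat_on UNIV) as)"
    for es and as :: "'a list"
    by (simp add: env_encode_def word_encode_def enc_prod_def enc_list_def enc_nat_def comp_def)
  have v: "v (map (to_nat_on E) es, map (to_nat_on UNIV) as) = \<nu> es as"
    if "(es, as) \<in> env_domain E" for es and as :: "'a list"
  proof -
    have "map (from_nat_into E) (map (to_nat_on E) es) = es"
      unfolding map_map by (rule map_idI) (use that finite_E in \<open>auto simp: env_domain_def countable_finite\<close>)
    moreover have "map (from_nat_into UNIV) (map (to_nat_on UNIV) as) = as"
      unfolding map_map by (rule map_idI) (auto simp: countable_finite)
    moreover have "enc (map (to_nat_on E) es, map (to_nat_on UNIV) as) 
        \<in> env_encode E ` (env_domain E :: ('o percept list \<times> 'a list) set)"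
      unfolding enc_env[symmetric] using that by (rule imageI)
    ultimately show ?thesis unfolding v_def by simp
  qed
  have "lsc v"
  proof (rule lsc_of_lower_semicomputable_on[OF \<nu>_lsc[unfolded lower_semicomputable_env_def]])
    show "v (dec (env_encode E x)) = (case x of (es, as) \<Rightarrow> \<nu> es as)" if "x \<in> env_domain E" for x
      using that by (cases x) (simp add: enc_env v)
    show "v y = 0" if "enc y \<notin> env_encode E ` (env_domain E :: ('o percept list \<times> 'a list) set)" for y
      using that by (simp add: v_def)
    show "0 \<le> v y" for y
    proof (cases "enc y \<in> env_encode E ` (env_domain E :: ('o percept list \<times> 'a list) set)")
      case True
      then obtain es and as :: "'a list" where ea: "(es, as) \<in> env_domain E" "enc y = env_encode E (es, as)"
        by auto
      then have "y = (map (to_nat_on E) es, map (to_nat_on UNIV) as)"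
        by (simp add: enc_env)
      then have "v y = \<nu> es as" using v[OF ea(1)] by simp
      then show ?thesis using semimeasure ea(1) unfolding chronological_semimeasure_def by fastforce
    qed (simp add: v_def)
  qed
  have "lsc \<gamma>"
    by (rule lsc_of_lower_semicomputable_on[OF \<gamma>_lsc]) (auto simp: dec_nat_def enc_nat_def \<gamma>_nonneg)
  have "coded_gain = (\<lambda>z. if valid_code CARD('a) (card E) z \<and> z \<noteq> []
    then \<gamma> (length z) * (r (snd (nthd z (length z - 1))) * v (map snd z, map fst z)) else 0)"
    unfolding fun_eq_iff
  proof
    fix z
    show "coded_gain z = (if valid_code CARD('a) (card E) z \<and> z \<noteq> []
      then \<gamma> (length z) * (r (snd (nthd z (length z - 1))) * v (map snd z, map fst z)) else 0)"
    proof (cases "valid_code CARD('a) (card E) z \<and> z \<noteq> []")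
      case True
      define h :: "('a, 'o) history" where "h = hist_decode E z"
      have z: "z = hist_code E h" and h: "h \<in> histories E"
        unfolding h_def using True finite_E by (simp_all add: hist_code_decode hist_decode_in_histories)
      have "h \<noteq> []" using True z by (auto simp: hist_code_def)
      have "nthd z (length z - 1) = last z"
        using True by (simp add: nthd_def last_conv_nth)
      also have "snd \<dots> = to_nat_on E (snd (last h))"
        using \<open>h \<noteq> []\<close> unfolding z hist_code_def by (simp add: last_map)
      moreover have "snd (last h) \<in> E"
        using h \<open>h \<noteq> []\<close> last_in_set[of "map snd h"] by (auto simp: histories_iff last_map)
      ultimately have "r (snd (nthd z (length z - 1))) = reward (snd (last h))"
        using finite_E by (simp add: r_def to_nat_on_less_card countable_finite)
      moreover have "(map snd z, map fst z) = (map (to_nat_on E) (map snd h), map (to_nat_on UNIV) (map fst h))"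
        unfolding z hist_code_def by simp
      then have "v (map snd z, map fst z) = prob h"
        by (simp only: v[OF env_domain_history[OF h]] hist_prob_def)
      ultimately show ?thesis
        using True unfolding coded_gain_def gain_def by (simp add: z h finite_E)
    qed (auto simp: coded_gain_def)
  qed
  moreover have "lsc \<dots>"
    by (intro lsc_if lsc_mult lsc_comp[OF \<open>lsc \<gamma>\<close>] lsc_comp[OF \<open>lsc r\<close>] lsc_comp[OF \<open>lsc v\<close>]
        computable_intros)
  ultimately show ?thesis by simp
qed

text \<open>The first component of \<open>x\<close> is the history code with the action number. The
  second is the index of the later supremum: a table and a bound on the codes that are
  summed.\<close>

definition table_gain :: "((nat \<times> nat) list \<times> nat) \<times> (nat list \<times> nat) \<Rightarrow> real" where
  "table_gain x = (\<Sum>c<snd (snd x).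
    if consistent_code CARD('a) (card E) (fst (fst x)) (snd (fst x)) (fst (snd x)) (dec c)
    then coded_gain (dec c) else 0)"

lemma lsc_table_gain: "lsc table_gain"
  unfolding table_gain_def
  by (intro lsc_sum lsc_if lsc_comp[OF lsc_coded_gain] computable_intros)

lemma coded_gain_nonneg: "0 \<le> coded_gain z"
  using lsc_nonneg[OF lsc_coded_gain] .

lemma table_gain_invalid:
  "\<not> valid_code CARD('a) (card E) h \<or> CARD('a) \<le> a \<Longrightarrow> table_gain ((h, a), k) = 0"
  by (auto simp: table_gain_def consistent_code_def)

text \<open>The table is completed to a genuine policy. Codes that pass the test decode to distinct
  continuations under it, so their gains form a finite part of its total gain.\<close>

lemma table_gain_le:
  assumes h: "h \<in> histories E"
  obtains \<pi> where "\<pi> h = a" "table_gain ((hist_code E h, to_nat_on UNIV a), (\<sigma>, K)) \<le> total_gain \<pi> h"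
proof -
  \<comment> \<open>\<open>from_nat_into\<close> turns table entries that name no action into some
    action. This causes no discrepancy, as no valid code can agree with such an entry.\<close>
  define \<pi> where "\<pi> y = (if y = h then a else from_nat_into UNIV (nthd \<sigma> (enc (hist_code E y))))" for y
  let ?C = "consistent_code CARD('a) (card E) (hist_code E h) (to_nat_on UNIV a) \<sigma>"
  let ?dec = "\<lambda>c. hist_decode E (dec c) :: ('a, 'o) history"
  let ?I = "{c. c < K \<and> ?C (dec c)}"
  have valid: "valid_code CARD('a) (card E) z" if "?C z" for z
    using that by (simp add: consistent_code_iff)
  have ext: "\<exists>es\<in>lists E. es \<noteq> [] \<and> hist_decode E z = continue \<pi> h es" if "?C z" for z
  proof -
    define y :: "('a, 'o) history" where "y = hist_decode E z"
    have z: "z = hist_code E y" and y: "y \<in> histories E"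
      unfolding y_def using valid[OF that] finite_E
      by (simp_all add: hist_code_decode hist_decode_in_histories)
    have len: "length h < length y" and pre: "take (length h) z = hist_code E h"
      and act: "\<And>i. length h \<le> i \<Longrightarrow> i < length y \<Longrightarrow>
        fst (z ! i) = table_action (hist_code E h) (to_nat_on UNIV a) \<sigma> (take i z)"
      using that unfolding consistent_code_iff by (simp_all add: z)
    have eq: "y = continue \<pi> h (map snd (drop (length h) y))"
    proof (rule eq_continueI)
      have "take (length h) y = hist_decode E (take (length h) z)"
        unfolding y_def by (rule take_hist_decode)
      then show "take (length h) y = h"
        by (simp add: pre finite_E h)
      fix i assume i: "length h \<le> i" "i < length y"
      have yi: "take i y = hist_decode E (take i z)"
        unfolding y_def by (rule take_hist_decode)
      have zi: "take i z = hist_code E (take i y)"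
        unfolding z by (rule take_hist_code)
      have "fst (y ! i) = from_nat_into UNIV (fst (z ! i))"
        unfolding y_def hist_decode_def using i z by simp
      also have "\<dots> = \<pi> (take i y)"
      proof (cases "take i z = hist_code E h")
        case True
        then have "take i y = h" unfolding yi by (simp add: finite_E h)
        then show ?thesis
          using act[OF i] True by (simp add: \<pi>_def table_action_def countable_finite)
      next
        case False
        then have "take i y \<noteq> h" using zi by auto
        then show ?thesis
          using act[OF i] False by (simp add: \<pi>_def table_action_def zi)
      qed
      finally show "fst (y ! i) = \<pi> (take i y)" .
    qed (use len in simp)
    have "map snd (drop (length h) y) \<in> lists E"
      using snd_in_percepts[OF y] by (force dest: in_set_dropD)
    moreover have "map snd (drop (length h) y) \<noteq> []" using len by simp
    ultimately show ?thesis using eq unfolding y_def by blast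
  qed
  have "inj_on ?dec ?I"
  proof (rule inj_onI)
    fix c c' assume c: "c \<in> ?I" "c' \<in> ?I" "?dec c = ?dec c'"
    then have "(dec c :: (nat \<times> nat) list) = dec c'"
      using hist_code_decode[OF finite_E valid] by (metis (mono_tags, lifting) mem_Collect_eq)
    then show "c = c'" by (metis enc_dec)
  qed
  have "table_gain ((hist_code E h, to_nat_on UNIV a), (\<sigma>, K)) = (\<Sum>c\<in>?I. coded_gain (dec c))"
    unfolding table_gain_def by (simp add: sum.inter_filter[symmetric])
  also have "\<dots> = (\<Sum>c\<in>?I. gain (?dec c))"
    by (rule sum.cong) (auto simp: coded_gain_def consistent_code_iff)
  also have "\<dots> = (\<Sum>y\<in>?dec ` ?I. gain y)"
    using \<open>inj_on ?dec ?I\<close> by (simp add: sum.reindex)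
  also have "\<dots> \<le> total_gain \<pi> h"
    by (rule sum_gain_le_total_gain[OF h]) (use ext in auto)
  finally show thesis
    using that[of \<pi>] by (simp add: \<pi>_def)
qed

text \<open>Finitely many gains already exceed \<open>x\<close>. They consult \<open>\<pi>\<close>
  at finitely many prefixes, so a long enough table reproduces \<open>\<pi>\<close> on all of
  them.\<close>

lemma less_table_gain:
  assumes h: "h \<in> histories E" and "\<pi> h = a" "x < total_gain \<pi> h"
  obtains k where "x < table_gain ((hist_code E h, to_nat_on UNIV a), k)"
proof -
  obtain n where n: "x < (\<Sum>y\<in>extensions \<pi> h n. gain y)"
    using less_total_gainE[OF assms(3) h] .
  \<comment> \<open>Including \<open>i = length y\<close> puts the codes of the extensions
    themselves into \<open>F\<close>, so that the same \<open>K\<close> bounds both the table and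
    the sum.\<close>
  define F where "F = (\<Union>y\<in>extensions \<pi> h n. (\<lambda>i. enc (hist_code E (take i y))) ` {..length y})"
  have "finite F"
    unfolding F_def by (intro finite_UN_I finite_extensions) simp
  then obtain K where K: "\<And>c. c \<in> F \<Longrightarrow> c < K"
    unfolding finite_nat_set_iff_bounded by blast
  define \<sigma> where "\<sigma> = map (\<lambda>c. to_nat_on UNIV (\<pi> (hist_decode E (dec c)))) [0..<K]"
  let ?C = "consistent_code CARD('a) (card E) (hist_code E h) (to_nat_on UNIV a) \<sigma>"
  let ?I = "{c. c < K \<and> ?C (dec c)}"
  let ?enc = "\<lambda>y. enc (hist_code E y)"
  have ext: "y \<in> histories E \<and> y \<noteq> [] \<and> ?enc y \<in> ?I" if y: "y \<in> extensions \<pi> h n" for y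
  proof -
    obtain es j where "y = continue \<pi> h es" and "es \<in> words E (Suc j)"
      using y unfolding extensions_def by blast
    then have es: "y = continue \<pi> h es" "es \<in> lists E" "es \<noteq> []"
      by (auto simp: words_def)
    have y_hist: "y \<in> histories E"
      unfolding es(1) by (intro continue_in_histories h es)
    have bound: "enc (hist_code E (take i y)) < K" if "i \<le> length y" for i
      by (rule K) (use that y in \<open>auto simp: F_def\<close>)
    have "?C (hist_code E y)"
      unfolding consistent_code_iff
    proof (intro conjI allI impI)
      show "take (length (hist_code E h)) (hist_code E y) = hist_code E h"
        by (simp add: take_hist_code es(1) take_continue)
      fix i assume i: "length (hist_code E h) \<le> i" "i < length (hist_code E y)"
      have "fst (hist_code E y ! i) = to_nat_on UNIV (fst (y ! i))"
        using i by (simp add: hist_code_def)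
      also have "fst (y ! i) = \<pi> (take i y)"
        using i fst_nth_continue[of h i es \<pi>] unfolding es(1) by simp
      also have "to_nat_on UNIV (\<pi> (take i y)) =
          table_action (hist_code E h) (to_nat_on UNIV a) \<sigma> (take i (hist_code E y))"
      proof -
        have yi: "take i y \<in> histories E"
          using y_hist by (auto simp: histories_iff take_map[symmetric] dest: in_set_takeD)
        then have "take i y = h" if "hist_code E (take i y) = hist_code E h"
          using that h finite_E by (metis hist_decode_code)
        moreover have "nthd \<sigma> (enc (hist_code E (take i y))) = to_nat_on UNIV (\<pi> (take i y))"
          using bound[of i] i yi by (simp add: \<sigma>_def nthd_def finite_E)
        ultimately show ?thesis
          using assms(2) by (auto simp: table_action_def take_hist_code)
      qed
      finally show "fst (hist_code E y ! i) =
          table_action (hist_code E h) (to_nat_on UNIV a) \<sigma> (take i (hist_code E y))" .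
    qed (use es h y_hist finite_E in \<open>simp_all add: valid_hist_code to_nat_on_less_card\<close>)
    then show ?thesis
      using bound[of "length y"] y_hist es by (auto dest: arg_cong[of _ _ length])
  qed
  have "inj_on ?enc (extensions \<pi> h n)"
    by (rule inj_onI) (metis ext enc_eq_iff hist_decode_code finite_E)
  have "(\<Sum>y\<in>extensions \<pi> h n. gain y) = (\<Sum>y\<in>extensions \<pi> h n. coded_gain (dec (?enc y)))"
    using ext by (intro sum.cong) (auto simp: coded_gain_hist_code)
  also have "\<dots> = (\<Sum>c\<in>?enc ` extensions \<pi> h n. coded_gain (dec c))"
    using \<open>inj_on ?enc (extensions \<pi> h n)\<close> by (simp add: sum.reindex)
  also have "\<dots> \<le> (\<Sum>c\<in>?I. coded_gain (dec c))"
    using ext by (intro sum_mono2 coded_gain_nonneg) auto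
  also have "\<dots> = table_gain ((hist_code E h, to_nat_on UNIV a), (\<sigma>, K))"
    unfolding table_gain_def by (simp add: sum.inter_filter[symmetric])
  finally show thesis using n by (intro that[of "(\<sigma>, K)"]) simp
qed

lemma
  assumes h: "h \<in> histories E"
  shows bdd_above_table_gain_hist: "bdd_above (range (\<lambda>k. table_gain ((hist_code E h, to_nat_on UNIV a), k)))"
    and SUP_table_gain: "(SUP k. table_gain ((hist_code E h, to_nat_on UNIV a), k)) = action_gain h a"
proof -
  let ?U = "\<lambda>k. table_gain ((hist_code E h, to_nat_on UNIV a), k)"
  have le: "?U k \<le> action_gain h a" for k
  proof -
    obtain \<pi> where "\<pi> h = a" "?U k \<le> total_gain \<pi> h"
      using table_gain_le[OF h, of a "fst k" "snd k"] by auto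
    then show ?thesis using total_gain_le_action_gain[OF h, of \<pi>] by simp
  qed
  then show bdd: "bdd_above (range ?U)" by (rule bdd_aboveI2)
  show "(SUP k. ?U k) = action_gain h a"
  proof (rule antisym)
    show "(SUP k. ?U k) \<le> action_gain h a" by (intro cSUP_least le) simp
    show "action_gain h a \<le> (SUP k. ?U k)"
      unfolding action_gain_def
    proof (rule cSUP_least)
      show "{\<pi>. \<pi> h = a} \<noteq> {}" by auto
      fix \<pi> assume "\<pi> \<in> {\<pi>. \<pi> h = a}"
      then have \<pi>: "\<pi> h = a" by simp
      show "total_gain \<pi> h \<le> (SUP k. ?U k)"
      proof (rule dense_le)
        fix x assume "x < total_gain \<pi> h"
        then obtain k where "x < ?U k" using less_table_gain[where \<pi> = \<pi>, OF h \<pi>] by blast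
        also have "\<dots> \<le> (SUP k. ?U k)" by (intro cSUP_upper bdd) simp
        finally show "x \<le> (SUP k. ?U k)" by simp
      qed
    qed
  qed
qed

text \<open>\<open>lsc_SUP_le_iff\<close> asks for a bound at every point of the coded type; a point
  that codes no history with an action has only zero sums.\<close>

lemma bdd_above_table_gain: "bdd_above (range (\<lambda>k. table_gain (x, k)))"
proof (cases x)
  case (Pair z b)
  show ?thesis
  proof (cases "valid_code CARD('a) (card E) z \<and> b < CARD('a)")
    case True
    define h :: "('a, 'o) history" where "h = hist_decode E z"
    define a :: 'a where "a = from_nat_into UNIV b"
    have "z = hist_code E h" "h \<in> histories E" "b = to_nat_on UNIV a"
      unfolding h_def a_def using True finite_E
      by (simp_all add: hist_code_decode hist_decode_in_histories from_nat_into_finite)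
    then show ?thesis using bdd_above_table_gain_hist Pair by simp
  next
    case False
    then have "table_gain (x, k) = 0" for k
      unfolding Pair by (intro table_gain_invalid) auto
    then show ?thesis by simp
  qed
qed

section \<open>The least best action and its graph\<close>

definition best_action :: "(nat \<times> nat) list \<Rightarrow> nat \<Rightarrow> bool" where
  "best_action z a \<longleftrightarrow> a < CARD('a) \<and>
    (\<forall>b<CARD('a). (SUP k. table_gain ((z, b), k)) \<le> (SUP k. table_gain ((z, a), k)))"

lemma ex_best_action: "\<exists>a. best_action z a"
proof -
  let ?Q = "\<lambda>a. SUP k. table_gain ((z, a), k)"
  have fin: "finite (?Q ` {..<CARD('a)})" "?Q ` {..<CARD('a)} \<noteq> {}"
    by (auto simp: lessThan_empty_iff bot_nat_def)
  obtain a where "Max (?Q ` {..<CARD('a)}) = ?Q a" "a \<in> {..<CARD('a)}"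
    using Max_in[OF fin] by (rule imageE)
  then show ?thesis
    using Max_ge[OF fin(1)] unfolding best_action_def by (metis imageI lessThan_iff)
qed

theorem ex_Delta0_optimal_policy: "\<exists>\<pi>. optimal_policy E \<gamma> \<nu> \<pi> \<and> Delta0 3 (policy_graph E \<pi>)"
proof -
  define \<pi> :: "('a, 'o) policy" where
    "\<pi> h = from_nat_into UNIV (LEAST a. best_action (hist_code E h) a)" for h
  have best: "best_action z (LEAST a. best_action z a)" for z
    by (rule LeastI_ex) (rule ex_best_action)
  have \<pi>: "to_nat_on UNIV (\<pi> h) = (LEAST a. best_action (hist_code E h) a)" for h
    using best[of "hist_code E h"] unfolding \<pi>_def best_action_def
    by (intro from_nat_into_finite) auto
  have "optimal_policy E \<gamma> \<nu> \<pi>"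
  proof (rule greedy_optimal)
    fix h :: "('a, 'o) history" and a :: 'a
    assume h: "h \<in> histories E"
    have "(SUP k. table_gain ((hist_code E h, to_nat_on UNIV a), k)) \<le>
        (SUP k. table_gain ((hist_code E h, to_nat_on UNIV (\<pi> h)), k))"
      using best[of "hist_code E h", folded \<pi>] unfolding best_action_def
      by (simp add: to_nat_on_less_card)
    then show "action_gain h a \<le> action_gain h (\<pi> h)"
      by (simp add: SUP_table_gain h)
  qed
  moreover have "Delta0 3 (policy_graph E \<pi>)"
  proof -
    obtain R :: "((nat \<times> nat) list \<times> nat) \<times> ((nat \<times> nat) list \<times> nat) \<Rightarrow>
        (nat list \<times> nat) \<times> nat \<times> nat \<times> nat \<Rightarrow> (nat list \<times> nat) \<times> nat \<Rightarrow> bool"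
      where R: "decidable (\<lambda>z. R (fst z) (fst (snd z)) (snd (snd z)))"
      "\<And>x y. (SUP k. table_gain (x, k)) \<le> (SUP k. table_gain (y, k)) \<longleftrightarrow> (\<forall>u. \<exists>v. R (x, y) u v)"
      by (rule lsc_SUP_le_iff[OF lsc_table_gain bdd_above_table_gain]) (rule that)
    \<comment> \<open>\<open>p = (b, u)\<close> merges the bounded quantifier over rival actions
      with the universal quantifier of the comparison; for \<open>b\<close> out of range the
      implication is vacuous.\<close>
    define W where "W z a p v \<longleftrightarrow> a < CARD('a) \<and> (fst p < CARD('a) \<longrightarrow> R ((z, fst p), (z, a)) (snd p) v)"
      for z a p v
    have W: "best_action z a \<longleftrightarrow> (\<forall>p. \<exists>v. W z a p v)" for z a
      unfolding best_action_def R(2) W_def split_paired_All fst_conv snd_conv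
      using zero_less_card_finite[where 'a = 'a] by blast
    have "decidable (\<lambda>z. W (fst z) (fst (snd z)) (fst (snd (snd z))) (snd (snd (snd z))))"
      unfolding W_def
      by (intro computable_intros computable_comp[OF R(1), of "\<lambda>z. (f z, g z, h z)" for f g h, simplified])
    moreover have "decidable (valid_code CARD('a) (card E))"
      by (intro computable_intros)
    ultimately have "Delta0 3 (enc ` {(z, a). valid_code CARD('a) (card E) z \<and> a = (LEAST a. best_action z a)})"
      unfolding W using ex_best_action[unfolded W] by (intro Delta0_3_least)
    \<comment> \<open>\<open>hist_code\<close> maps the histories bijectively onto the valid codes,
      so each element of the right-hand set comes from a history.\<close>
    moreover have "policy_graph E \<pi> =
        enc ` {(z, a). valid_code CARD('a) (card E) z \<and> a = (LEAST a. best_action z a)}"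
    proof (intro set_eqI iffI)
      fix c assume "c \<in> policy_graph E \<pi>"
      then obtain h where h: "h \<in> histories E" "c = prod_encode (history_encode E h, to_nat_on UNIV (\<pi> h))"
        unfolding policy_graph_def by auto
      then have "c = enc (hist_code E h, LEAST a. best_action (hist_code E h) a)"
        by (simp add: history_encode_eq enc_prod_def enc_nat_def \<pi>)
      then show "c \<in> enc ` {(z, a). valid_code CARD('a) (card E) z \<and> a = (LEAST a. best_action z a)}"
        using valid_hist_code[OF finite_E h(1)] by auto
    next
      fix c assume "c \<in> enc ` {(z, a). valid_code CARD('a) (card E) z \<and> a = (LEAST a. best_action z a)}"
      then obtain z where z: "valid_code CARD('a) (card E) z" "c = enc (z, LEAST a. best_action z a)"
        by auto
      define h :: "('a, 'o) history" where "h = hist_decode E z"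
      have "z = hist_code E h" "h \<in> histories E"
        unfolding h_def using z(1) finite_E by (simp_all add: hist_code_decode hist_decode_in_histories)
      then have "c = prod_encode (history_encode E h, to_nat_on UNIV (\<pi> h))"
        using z(2) by (simp add: history_encode_eq enc_prod_def enc_nat_def \<pi>)
      with \<open>h \<in> histories E\<close> show "c \<in> policy_graph E \<pi>"
        unfolding policy_graph_def by blast
    qed
    ultimately show ?thesis by simp
  qed
  ultimately show ?thesis by blast
qed

end

theorem corollary6p10:
  fixes E :: "'o percept set"
    and \<gamma> :: "nat \<Rightarrow> real"
    and \<nu> :: "('a::finite, 'o) environment"
  assumes "finite E"
    and "\<forall>e \<in> E. 0 \<le> reward e \<and> reward e \<le> 1"
    and "computable_on (to_nat_on E) E reward"
    and "\<forall>k. \<gamma> k \<ge> 0"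
    and "summable \<gamma>"
    and "computable_on id UNIV \<gamma>"
    and "chronological_semimeasure E \<nu>"
    and "lower_semicomputable_env E \<nu>"
  shows "\<exists>\<pi>. optimal_policy E \<gamma> \<nu> \<pi> \<and> Delta0 3 (policy_graph E \<pi>)"
proof -
  interpret semicomputable_environment E \<gamma> \<nu>
    by standard (use assms in \<open>auto simp: computable_on_def\<close>)
  show ?thesis by (rule ex_Delta0_optimal_policy)
qed

end
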